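(* The following problem is undecidable: given a semilinear equivariant deterministic finite automaton with the integer atoms whose input alphabet is $\mathbb{Z}$, decide whether the automaton accepts some constant word, i.e.\ some word of the form $x^n$ with $x\in\mathbb{Z}$ and $n\ge 0$.
   Context: Integer atoms: the atoms are the integers $\mathbb{Z}$ with the successor function; the automorphisms are exactly the translations $x\mapsto x+z$, acting hereditarily on sets built from atoms. A set, relation or function is equivariant if invariant under all translations; an equivariant set is orbit-finite if it is a finite union of orbits. For $k\ge1$, $\mathbb{Z}_k$ is the integers modulo $k$ with translations acting by addition, $\mathbb{Z}_0=\mathbb{Z}$; every equivariant single-orbit set is equivariantly isomorphic to some $\mathbb{Z}_k$. A monomial set is a finite product of equivariant single-orbit sets, a polynomial set a finite disjoint union of monomials. A subset of $\mathbb{Z}^m$ is semilinear if Presburger-definable; every subset of $\mathbb{Z}_k$ ($k\ge1$) is semilinear; subsets of general monomials and polynomial sets are semilinear if semilinear after transport along equivariant isomorphisms to disjoint unions of monomials $\mathbb{Z}^m$, $\mathbb{Z}_k$ (via $\mathbb{Z}_k\times\mathbb{Z}\cong k$ copies of $\mathbb{Z}$, $\mathbb{Z}_k\times\mathbb{Z}_l\cong\mathbb{Z}_{\mathrm{lcm}(k,l)}$), componentwise. A DFA with atoms consists of an orbit-finite equivariant alphabet $A$, an orbit-finite equivariant state set $Q$, a transition function $\delta:Q\times A\to Q$, an initial state and accepting states $F\subseteq Q$; it is equivariant if $\delta$, the initial state and $F$ are equivariant, and semilinear if $\delta$ is a semilinear subset of $Q\times A\times Q$. *)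

theory Defs
  imports Main "HOL-Library.Nat_Bijection"
begin

section \<open>Partial recursive functions\<close>

datatype recf =
    Zero
  | Succ
  | Proj nat
  | Comp recf "recf list"
  | PrimRec recf recf
  | Mu recf

text \<open>\<open>rec_eval f xs y\<close>: the partial recursive function \<open>f\<close> is defined on
  the arguments \<open>xs\<close> and has value \<open>y\<close> there.  The recursion argument of \<open>PrimRec\<close>
  and the search variable of \<open>Mu\<close> come first.\<close>

inductive rec_eval :: "recf \<Rightarrow> nat list \<Rightarrow> nat \<Rightarrow> bool" where
  "rec_eval Zero xs 0"
| "rec_eval Succ [x] (Suc x)"
| "i < length xs \<Longrightarrow> rec_eval (Proj i) xs (xs ! i)"
| "list_all2 (\<lambda>g y. rec_eval g xs y) gs ys \<Longrightarrow> rec_eval f ys y \<Longrightarrow> rec_eval (Comp f gs) xs y"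
| "rec_eval f xs y \<Longrightarrow> rec_eval (PrimRec f g) (0 # xs) y"
| "rec_eval (PrimRec f g) (n # xs) r \<Longrightarrow> rec_eval g (n # r # xs) y \<Longrightarrow>
    rec_eval (PrimRec f g) (Suc n # xs) y"
| "rec_eval f (n # xs) 0 \<Longrightarrow> \<forall>m<n. \<exists>r. rec_eval f (m # xs) (Suc r) \<Longrightarrow> rec_eval (Mu f) xs n"

inductive_cases rec_eval_ZeroE: "rec_eval Zero xs y"
inductive_cases rec_eval_SuccE: "rec_eval Succ xs y"
inductive_cases rec_eval_ProjE: "rec_eval (Proj i) xs y"
inductive_cases rec_eval_CompE: "rec_eval (Comp f gs) xs y"
inductive_cases rec_eval_PrimRec_0E: "rec_eval (PrimRec f g) (0 # xs) y"
inductive_cases rec_eval_PrimRec_SucE: "rec_eval (PrimRec f g) (Suc n # xs) y"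
inductive_cases rec_eval_MuE: "rec_eval (Mu f) xs y"

lemma rec_eval_deterministic: "rec_eval f xs y \<Longrightarrow> rec_eval f xs y' \<Longrightarrow> y = y'"
proof (induction arbitrary: y' rule: rec_eval.induct)
  case (1 xs)
  then show ?case by (blast elim: rec_eval_ZeroE)
next
  case (2 x)
  then show ?case by (blast elim: rec_eval_SuccE)
next
  case (3 i xs)
  then show ?case by (blast elim: rec_eval_ProjE)
next
  case (4 xs gs ys f y)
  from "4.prems" obtain ys' where ys': "list_all2 (\<lambda>g y. rec_eval g xs y) gs ys'" "rec_eval f ys' y'"
    by (rule rec_eval_CompE)
  have "ys = ys'"
    using "4.IH"(1) ys'(1) by (auto simp: list_all2_conv_all_nth intro: nth_equalityI)
  then show ?case using "4.IH"(2) ys'(2) by blast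
next
  case (5 f xs y g)
  from "5.prems" have "rec_eval f xs y'" by (rule rec_eval_PrimRec_0E)
  then show ?case by (rule "5.IH")
next
  case (6 f g n xs r y)
  from "6.prems" obtain r' where "rec_eval (PrimRec f g) (n # xs) r'" "rec_eval g (n # r' # xs) y'"
    by (rule rec_eval_PrimRec_SucE)
  then show ?case using "6.IH" by blast
next
  case (7 f n xs)
  from "7.prems" have *: "rec_eval f (y' # xs) 0" "\<forall>m<y'. \<exists>r. rec_eval f (m # xs) (Suc r)"
    by (blast elim: rec_eval_MuE)+
  show ?case
  proof (rule linorder_cases[of n y'])
    assume "n < y'"
    then obtain r where "rec_eval f (n # xs) (Suc r)" using *(2) by blast
    then have "0 = Suc r" by (rule "7.IH"(1))
    then show ?thesis by simp
  next
    assume "y' < n"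
    then obtain r where "\<forall>z. rec_eval f (y' # xs) z \<longrightarrow> Suc r = z" using "7.IH"(2) by blast
    then have "Suc r = 0" using *(1) by blast
    then show ?thesis by simp
  qed
qed

text \<open>The problem ``given an object in \<open>D\<close>, decide whether it satisfies \<open>P\<close>'', where
  \<open>pres c m\<close> says that the number \<open>c\<close> is a finite presentation of the object \<open>m\<close>.
  The algorithm must halt and be correct on all presentations of objects in \<open>D\<close>; nothing is
  required of it on other inputs.\<close>

definition decidable_problem :: "(nat \<Rightarrow> 'm \<Rightarrow> bool) \<Rightarrow> 'm set \<Rightarrow> ('m \<Rightarrow> bool) \<Rightarrow> bool" where
  "decidable_problem pres D P \<longleftrightarrow>
    (\<exists>f. \<forall>c m. m \<in> D \<and> pres c m \<longrightarrow> rec_eval f [c] (if P m then 1 else 0))"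


section \<open>Presburger arithmetic\<close>

datatype pterm = Var nat | Const int | Add pterm pterm

text \<open>Variables are de Bruijn indices: \<open>Ex\<close> binds index 0.\<close>

datatype pform = Eq pterm pterm | Le pterm pterm | Neg pform | And pform pform | Ex pform

primrec tval :: "(nat \<Rightarrow> int) \<Rightarrow> pterm \<Rightarrow> int" where
  "tval e (Var i) = e i"
| "tval e (Const c) = c"
| "tval e (Add s t) = tval e s + tval e t"

primrec sat :: "(nat \<Rightarrow> int) \<Rightarrow> pform \<Rightarrow> bool" where
  "sat e (Eq s t) \<longleftrightarrow> tval e s = tval e t"
| "sat e (Le s t) \<longleftrightarrow> tval e s \<le> tval e t"
| "sat e (Neg \<phi>) \<longleftrightarrow> \<not> sat e \<phi>"
| "sat e (And \<phi> \<psi>) \<longleftrightarrow> sat e \<phi> \<and> sat e \<psi>"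
| "sat e (Ex \<phi>) \<longleftrightarrow> (\<exists>x. sat (case_nat x e) \<phi>)"

primrec tvars_below :: "nat \<Rightarrow> pterm \<Rightarrow> bool" where
  "tvars_below m (Var i) \<longleftrightarrow> i < m"
| "tvars_below m (Const c) \<longleftrightarrow> True"
| "tvars_below m (Add s t) \<longleftrightarrow> tvars_below m s \<and> tvars_below m t"

primrec fvars_below :: "nat \<Rightarrow> pform \<Rightarrow> bool" where
  "fvars_below m (Eq s t) \<longleftrightarrow> tvars_below m s \<and> tvars_below m t"
| "fvars_below m (Le s t) \<longleftrightarrow> tvars_below m s \<and> tvars_below m t"
| "fvars_below m (Neg \<phi>) \<longleftrightarrow> fvars_below m \<phi>"
| "fvars_below m (And \<phi> \<psi>) \<longleftrightarrow> fvars_below m \<phi> \<and> fvars_below m \<psi>"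
| "fvars_below m (Ex \<phi>) \<longleftrightarrow> fvars_below (Suc m) \<phi>"

definition defines_set :: "nat \<Rightarrow> pform \<Rightarrow> int list set \<Rightarrow> bool" where
  "defines_set m \<phi> S \<longleftrightarrow> fvars_below m \<phi> \<and> S = {ys. length ys = m \<and> sat ((!) ys) \<phi>}"


section \<open>Sets with a translation action\<close>

definition translation_action :: "'x set \<Rightarrow> (int \<Rightarrow> 'x \<Rightarrow> 'x) \<Rightarrow> bool" where
  "translation_action X act \<longleftrightarrow>
    (\<forall>x\<in>X. act 0 x = x) \<and>
    (\<forall>z. \<forall>x\<in>X. act z x \<in> X) \<and>
    (\<forall>y z. \<forall>x\<in>X. act (y + z) x = act y (act z x))"

definition orbit_finite :: "'x set \<Rightarrow> (int \<Rightarrow> 'x \<Rightarrow> 'x) \<Rightarrow> bool" where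
  "orbit_finite X act \<longleftrightarrow> (\<exists>R. finite R \<and> R \<subseteq> X \<and> X = (\<Union>x\<in>R. range (\<lambda>z. act z x)))"

text \<open>\<open>Zmod k\<close> represents the integers modulo \<open>k\<close> by their least nonnegative residues; since
  \<open>x mod 0 = x\<close>, the case \<open>k = 0\<close> (all integers) follows the same pattern.\<close>

definition Zmod :: "nat \<Rightarrow> int set" where
  "Zmod k = {x. x mod int k = x}"

definition Zmod_sum :: "nat list \<Rightarrow> (nat \<times> int) set" where
  "Zmod_sum ks = {(i, x). i < length ks \<and> x \<in> Zmod (ks ! i)}"

definition Zmod_sum_act :: "nat list \<Rightarrow> int \<Rightarrow> nat \<times> int \<Rightarrow> nat \<times> int" where
  "Zmod_sum_act ks z = (\<lambda>(i, x). (i, (x + z) mod int (ks ! i)))"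


section \<open>Semilinear subsets of monomials\<close>

definition monomial :: "nat list \<Rightarrow> int list set" where
  "monomial ks = {xs. list_all2 (\<lambda>x k. x \<in> Zmod k) xs ks}"

text \<open>If some \<open>k\<close> in \<open>ks\<close> is 0 and \<open>m\<close> is the number of such factors, then repeated use of
  \<open>\<int>\<^sub>k \<times> \<int> \<cong> k\<close> copies of \<open>\<int>\<close> makes the monomial a disjoint union of copies of
  \<open>\<int>\<^sup>m\<close>, one for every choice \<open>cs\<close> of an offset in each finite factor; \<open>mono_copy ks cs\<close>
  is the equivariant embedding of that copy, in which the coordinate in a finite factor is the
  offset plus the first integer coordinate.  (The entry of \<open>cs\<close> at an infinite factor is
  a dummy 0.)  If all factors are finite, then \<open>m = 0\<close>, the copies are just the elements
  of the monomial, and every subset is semilinear.\<close>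

definition mono_offsets :: "nat list \<Rightarrow> int list list" where
  "mono_offsets ks = product_lists (map (\<lambda>k. if k = 0 then [0] else map int [0..<k]) ks)"

definition mono_dim :: "nat list \<Rightarrow> nat" where
  "mono_dim ks = length (filter (\<lambda>k. k = 0) ks)"

fun mono_copy_base :: "int \<Rightarrow> nat list \<Rightarrow> int list \<Rightarrow> int list \<Rightarrow> int list" where
  "mono_copy_base b (0 # ks) (c # cs) (y # ys) = y # mono_copy_base b ks cs ys"
| "mono_copy_base b (Suc k # ks) (c # cs) ys =
    ((b + c) mod int (Suc k)) # mono_copy_base b ks cs ys"
| "mono_copy_base b _ _ _ = []"

definition mono_copy :: "nat list \<Rightarrow> int list \<Rightarrow> int list \<Rightarrow> int list" where
  "mono_copy ks cs ys = mono_copy_base (case ys of [] \<Rightarrow> 0 | y # _ \<Rightarrow> y) ks cs ys"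

definition presents_mono_subset :: "nat list \<Rightarrow> pform list \<Rightarrow> int list set \<Rightarrow> bool" where
  "presents_mono_subset ks \<phi>s S \<longleftrightarrow>
    S \<subseteq> monomial ks \<and>
    list_all2 (\<lambda>cs \<phi>. defines_set (mono_dim ks) \<phi> {ys. length ys = mono_dim ks \<and> mono_copy ks cs ys \<in> S})
      (mono_offsets ks) \<phi>s"

definition semilinear_mono_subset :: "nat list \<Rightarrow> int list set \<Rightarrow> bool" where
  "semilinear_mono_subset ks S \<longleftrightarrow> (\<exists>\<phi>s. presents_mono_subset ks \<phi>s S)"


section \<open>Deterministic finite automata with integer atoms\<close>

record ('q, 'a) dfa =
  states :: "'q set"
  state_act :: "int \<Rightarrow> 'q \<Rightarrow> 'q"
  alphabet :: "'a set"
  letter_act :: "int \<Rightarrow> 'a \<Rightarrow> 'a"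
  delta :: "'q \<Rightarrow> 'a \<Rightarrow> 'q"
  initial :: 'q
  accepting :: "'q set"

definition dfa_with_atoms :: "('q, 'a) dfa \<Rightarrow> bool" where
  "dfa_with_atoms M \<longleftrightarrow>
    translation_action (states M) (state_act M) \<and> orbit_finite (states M) (state_act M) \<and>
    translation_action (alphabet M) (letter_act M) \<and> orbit_finite (alphabet M) (letter_act M) \<and>
    (\<forall>q\<in>states M. \<forall>a\<in>alphabet M. delta M q a \<in> states M) \<and>
    initial M \<in> states M \<and> accepting M \<subseteq> states M"

definition equivariant_dfa :: "('q, 'a) dfa \<Rightarrow> bool" where
  "equivariant_dfa M \<longleftrightarrow>
    dfa_with_atoms M \<and>
    (\<forall>z. \<forall>q\<in>states M. \<forall>a\<in>alphabet M.
      delta M (state_act M z q) (letter_act M z a) = state_act M z (delta M q a)) \<and>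
    (\<forall>z. state_act M z (initial M) = initial M) \<and>
    (\<forall>z. state_act M z ` accepting M = accepting M)"

definition accepts :: "('q, 'a) dfa \<Rightarrow> 'a list \<Rightarrow> bool" where
  "accepts M w \<longleftrightarrow> set w \<subseteq> alphabet M \<and> foldl (delta M) (initial M) w \<in> accepting M"

definition integer_alphabet :: "('q, int) dfa \<Rightarrow> bool" where
  "integer_alphabet M \<longleftrightarrow> alphabet M = UNIV \<and> letter_act M = (+)"

text \<open>An equivariant isomorphism between the state set and a disjoint union of sets
  \<open>\<int>\<^sub>k\<close>.\<close>

definition states_iso :: "('q, 'a) dfa \<Rightarrow> nat list \<Rightarrow> ('q \<Rightarrow> nat \<times> int) \<Rightarrow> bool" where
  "states_iso M ks h \<longleftrightarrow>
    bij_betw h (states M) (Zmod_sum ks) \<and>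
    (\<forall>z. \<forall>q\<in>states M. h (state_act M z q) = Zmod_sum_act ks z (h q))"

text \<open>The part of the (transported) graph of the transition function of an automaton over
  \<open>\<int>\<close> that lies in the component \<open>\<int>\<^sub>k \<times> \<int> \<times> \<int>\<^sub>l\<close>, where \<open>k\<close>, \<open>l\<close> are the entries
  of \<open>ks\<close> at \<open>i\<close>, \<open>j\<close>.\<close>

definition delta_component :: "('q, int) dfa \<Rightarrow> ('q \<Rightarrow> nat \<times> int) \<Rightarrow> nat \<Rightarrow> nat \<Rightarrow> int list set" where
  "delta_component M h i j =
    {[x, a, y] | x a y. \<exists>q\<in>states M. h q = (i, x) \<and> h (delta M q a) = (j, y)}"

definition semilinear_dfa :: "('q, int) dfa \<Rightarrow> bool" where
  "semilinear_dfa M \<longleftrightarrow>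
    (\<exists>ks h. states_iso M ks h \<and>
      (\<forall>i<length ks. \<forall>j<length ks.
        semilinear_mono_subset [ks ! i, 0, ks ! j] (delta_component M h i j)))"


section \<open>Finite presentations of semilinear equivariant automata\<close>

text \<open>A code \<open>(ks, i0, fs, tab)\<close> consists of the orbits of the state set, the index of the orbit
  of the initial state (a singleton orbit by equivariance, so that its element is
  \<open>(i0, 0)\<close>), the indices of the orbits of accepting states (whose union is the
  accepting set by equivariance), and the table of formulas presenting the transition function.\<close>

type_synonym dfa_code = "nat list \<times> nat \<times> nat list \<times> pform list list list"

fun code_presents :: "dfa_code \<Rightarrow> ('q, int) dfa \<Rightarrow> bool" where
  "code_presents (ks, i0, fs, tab) M \<longleftrightarrow>
    (\<exists>h. states_iso M ks h \<and>
      h (initial M) = (i0, 0) \<and>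
      h ` accepting M = {(i, x) \<in> Zmod_sum ks. i \<in> set fs} \<and>
      length tab = length ks \<and>
      (\<forall>i<length ks. length (tab ! i) = length ks \<and>
        (\<forall>j<length ks.
          presents_mono_subset [ks ! i, 0, ks ! j] (tab ! i ! j) (delta_component M h i j))))"

primrec encode_pterm :: "pterm \<Rightarrow> nat" where
  "encode_pterm (Var i) = prod_encode (0, i)"
| "encode_pterm (Const c) = prod_encode (1, int_encode c)"
| "encode_pterm (Add s t) = prod_encode (2, prod_encode (encode_pterm s, encode_pterm t))"

primrec encode_pform :: "pform \<Rightarrow> nat" where
  "encode_pform (Eq s t) = prod_encode (0, prod_encode (encode_pterm s, encode_pterm t))"
| "encode_pform (Le s t) = prod_encode (1, prod_encode (encode_pterm s, encode_pterm t))"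
| "encode_pform (Neg \<phi>) = prod_encode (2, encode_pform \<phi>)"
| "encode_pform (And \<phi> \<psi>) = prod_encode (3, prod_encode (encode_pform \<phi>, encode_pform \<psi>))"
| "encode_pform (Ex \<phi>) = prod_encode (4, encode_pform \<phi>)"

fun encode_dfa_code :: "dfa_code \<Rightarrow> nat" where
  "encode_dfa_code (ks, i0, fs, tab) =
    prod_encode (list_encode ks, prod_encode (i0, prod_encode (list_encode fs,
      list_encode (map (\<lambda>row. list_encode (map (\<lambda>\<phi>s. list_encode (map encode_pform \<phi>s)) row)) tab))))"

definition dfa_presentation :: "nat \<Rightarrow> ('q, int) dfa \<Rightarrow> bool" where
  "dfa_presentation n M \<longleftrightarrow> (\<exists>c. n = encode_dfa_code c \<and> code_presents c M)"

lemma encode_pterm_inject: "encode_pterm s = encode_pterm t \<longleftrightarrow> s = t"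
proof (induction s arbitrary: t)
  case (Var x) then show ?case by (cases t) auto
next
  case (Const x) then show ?case by (cases t) (auto simp: int_encode_eq)
next
  case (Add s1 s2) then show ?case by (cases t) auto
qed

lemma encode_pform_inject: "encode_pform \<phi> = encode_pform \<psi> \<longleftrightarrow> \<phi> = \<psi>"
proof (induction \<phi> arbitrary: \<psi>)
  case (Eq s t) then show ?case by (cases \<psi>) (auto simp: encode_pterm_inject)
next
  case (Le s t) then show ?case by (cases \<psi>) (auto simp: encode_pterm_inject)
next
  case (Neg \<phi>) then show ?case by (cases \<psi>) auto
next
  case (And \<phi>1 \<phi>2) then show ?case by (cases \<psi>) auto
next
  case (Ex \<phi>) then show ?case by (cases \<psi>) auto
qed

lemma inj_encode_dfa_code: "inj encode_dfa_code"
proof -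
  have 1: "inj (map encode_pform)"
    by (rule inj_mapI) (auto simp: inj_def encode_pform_inject)
  have 2: "inj (\<lambda>\<phi>s. list_encode (map encode_pform \<phi>s))"
    using 1 by (auto simp: inj_def list_encode_eq)
  have 3: "inj (\<lambda>row. list_encode (map (\<lambda>\<phi>s. list_encode (map encode_pform \<phi>s)) row))"
    using inj_mapI[OF 2] by (auto simp: inj_def list_encode_eq)
  show ?thesis
    using inj_mapI[OF 3] by (auto simp: inj_def list_encode_eq)
qed

text \<open>Adequacy of the codes: every automaton under consideration has a presentation.\<close>

lemma semilinear_equivariant_dfa_has_code:
  assumes eqv: "equivariant_dfa M" and sl: "semilinear_dfa M"
  shows "\<exists>c. code_presents c M"
proof -
  obtain ks h where h: "states_iso M ks h"
    and comp: "\<forall>i<length ks. \<forall>j<length ks.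
        semilinear_mono_subset [ks ! i, 0, ks ! j] (delta_component M h i j)"
    using sl by (auto simp: semilinear_dfa_def)
  from comp obtain T where T: "\<And>i j. i < length ks \<Longrightarrow> j < length ks \<Longrightarrow>
      presents_mono_subset [ks ! i, 0, ks ! j] (T i j) (delta_component M h i j)"
    unfolding semilinear_mono_subset_def by metis
  define tab where "tab = map (\<lambda>i. map (T i) [0..<length ks]) [0..<length ks]"
  have bij: "bij_betw h (states M) (Zmod_sum ks)"
    and act: "\<And>z q. q \<in> states M \<Longrightarrow> h (state_act M z q) = Zmod_sum_act ks z (h q)"
    using h by (auto simp: states_iso_def)
  have init: "initial M \<in> states M" "\<And>z. state_act M z (initial M) = initial M"
    and acc: "accepting M \<subseteq> states M" "\<And>z. state_act M z ` accepting M = accepting M"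
    using eqv by (auto simp: equivariant_dfa_def dfa_with_atoms_def)
  obtain i0 x0 where i0: "h (initial M) = (i0, x0)" by fastforce
  have "(x0 + z) mod int (ks ! i0) = x0" for z
    using act[OF init(1), of z] init(2) i0 by (simp add: Zmod_sum_act_def)
  from this[of "- x0"] have "x0 = 0" by simp
  define fs where "fs = filter (\<lambda>i. i \<in> fst ` h ` accepting M) [0..<length ks]"
  have "h ` accepting M = {(i, x) \<in> Zmod_sum ks. i \<in> set fs}"
  proof (intro equalityI subsetI)
    fix p assume p: "p \<in> h ` accepting M"
    then have "p \<in> Zmod_sum ks" using acc(1) bij by (auto simp: bij_betw_def)
    moreover have "fst p \<in> fst ` h ` accepting M" using p by (rule imageI)
    ultimately show "p \<in> {(i, x) \<in> Zmod_sum ks. i \<in> set fs}"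
      by (auto simp: fs_def Zmod_sum_def)
  next
    fix p assume "p \<in> {(i, x) \<in> Zmod_sum ks. i \<in> set fs}"
    then obtain i x where p: "p = (i, x)" "x \<in> Zmod (ks ! i)" and i: "i \<in> fst ` h ` accepting M"
      by (auto simp: fs_def Zmod_sum_def)
    from i obtain q where q: "q \<in> accepting M" "fst (h q) = i" by auto
    then obtain y where y: "h q = (i, y)" by (cases "h q") auto
    have "h (state_act M (x - y) q) = (i, x mod int (ks ! i))"
      using act[of q "x - y"] q(1) acc(1) y by (auto simp: Zmod_sum_act_def)
    also have "\<dots> = p" using p by (simp add: Zmod_def)
    finally have "p = h (state_act M (x - y) q)" ..
    moreover have "state_act M (x - y) q \<in> accepting M" using q(1) acc(2)[of "x - y"] by auto
    ultimately show "p \<in> h ` accepting M" by blast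
  qed
  then have "code_presents (ks, i0, fs, tab) M"
    using h i0 \<open>x0 = 0\<close> T by (auto simp: tab_def intro!: exI[of _ h])
  then show ?thesis ..
qed

end

theory Submission
  imports Defs "HOL-Computational_Algebra.Primes" "HOL-Library.Infinite_Set"
begin

text \<open>Relative to the letter \<open>a\<close> of a constant word, a state in an orbit \<open>\<int>\<close> is an integer, and
  a transition of an equivariant automaton is an arbitrary (semilinear) function of that integer.
  Multiplication by a constant and division with a divisibility test are semilinear, so reading a
  constant word can simulate a counter machine whose counters are the multiplicities of distinct
  primes in a single integer.  Such machines compute all partial recursive functions.  If a
  recursive \<open>f\<close> decided the problem, one could build a machine that starts from an integer
  describing its own program, computes the code of its own automaton, applies \<open>f\<close> to it, and halts
  precisely if the answer is ``no constant word is accepted''.  As the input of the machine enters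
  its automaton only through the constant in the initial transition, the code is a recursive
  function of the input.\<close>

section \<open>Total recursive functions\<close>

text \<open>Functions on argument lists let the recursiveness of an explicit expression be proved by
  following its syntax; this is how \<open>self_code\<close> is treated. The number \<open>k\<close>
  fixes the arity.\<close>

definition recursive :: "nat \<Rightarrow> (nat list \<Rightarrow> nat) \<Rightarrow> bool" where
  "recursive k F \<longleftrightarrow> (\<exists>f. \<forall>xs. length xs = k \<longrightarrow> rec_eval f xs (F xs))"

lemma recursive_comp:
  assumes F: "recursive (length Gs) F" and Gs: "\<And>G. G \<in> set Gs \<Longrightarrow> recursive k G"
  shows "recursive k (\<lambda>xs. F (map (\<lambda>G. G xs) Gs))"
proof -
  obtain f where f: "\<And>xs. length xs = length Gs \<Longrightarrow> rec_eval f xs (F xs)"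
    using F by (auto simp: recursive_def)
  obtain g where g: "\<And>G xs. G \<in> set Gs \<Longrightarrow> length xs = k \<Longrightarrow> rec_eval (g G) xs (G xs)"
    using Gs unfolding recursive_def by metis
  have "rec_eval (Comp f (map g Gs)) xs (F (map (\<lambda>G. G xs) Gs))" if "length xs = k" for xs
  proof (rule rec_eval.intros(4))
    show "list_all2 (\<lambda>h y. rec_eval h xs y) (map g Gs) (map (\<lambda>G. G xs) Gs)"
      using g that by (auto simp: list_all2_conv_all_nth)
    show "rec_eval f (map (\<lambda>G. G xs) Gs) (F (map (\<lambda>G. G xs) Gs))"
      by (rule f) simp
  qed
  then show ?thesis by (auto simp: recursive_def)
qed

lemma recursive_comp1:
  assumes "recursive 1 (\<lambda>xs. F (xs ! 0))" "recursive k G"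
  shows "recursive k (\<lambda>xs. F (G xs))"
  using recursive_comp[of "[G]" "\<lambda>xs. F (xs ! 0)" k] assms by simp

lemma recursive_comp2:
  assumes "recursive 2 (\<lambda>xs. F (xs ! 0) (xs ! 1))" "recursive k G" "recursive k H"
  shows "recursive k (\<lambda>xs. F (G xs) (H xs))"
proof -
  have "recursive k G'" if "G' \<in> set [G, H]" for G' using that assms by auto
  moreover have "length [G, H] = 2" by simp
  ultimately show ?thesis
    using recursive_comp[of "[G, H]" "\<lambda>xs. F (xs ! 0) (xs ! 1)" k] assms(1)
    by (simp add: numeral_2_eq_2)
qed

lemma recursive_arg: "i < k \<Longrightarrow> recursive k (\<lambda>xs. xs ! i)"
  unfolding recursive_def by (intro exI[of _ "Proj i"]) (auto intro: rec_eval.intros)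

lemma recursive_Suc:
  assumes "recursive k F"
  shows "recursive k (\<lambda>xs. Suc (F xs))"
proof -
  have "rec_eval Succ xs (Suc (xs ! 0))" if "length xs = 1" for xs
    using that by (cases xs) (auto intro: rec_eval.intros)
  then have "recursive 1 (\<lambda>xs. Suc (xs ! 0))" by (auto simp: recursive_def)
  then show ?thesis using assms by (rule recursive_comp1)
qed

lemma recursive_const: "recursive k (\<lambda>_. n)"
proof (induction n)
  case 0
  show ?case unfolding recursive_def by (intro exI[of _ Zero]) (auto intro: rec_eval.intros)
qed (rule recursive_Suc)

lemma recursive_primrec:
  assumes F: "recursive k F" and G: "recursive (Suc (Suc k)) G"
    and H0: "\<And>xs. length xs = k \<Longrightarrow> H (0 # xs) = F xs"
    and HS: "\<And>n xs. length xs = k \<Longrightarrow> H (Suc n # xs) = G (n # H (n # xs) # xs)"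
  shows "recursive (Suc k) H"
proof -
  obtain f where f: "\<And>xs. length xs = k \<Longrightarrow> rec_eval f xs (F xs)"
    using F by (auto simp: recursive_def)
  obtain g where g: "\<And>xs. length xs = Suc (Suc k) \<Longrightarrow> rec_eval g xs (G xs)"
    using G by (auto simp: recursive_def)
  have "rec_eval (PrimRec f g) (n # xs) (H (n # xs))" if "length xs = k" for n xs
    using that
  proof (induction n)
    case 0
    then show ?case using f H0 by (auto intro: rec_eval.intros)
  next
    case (Suc n)
    then show ?case using g[of "n # H (n # xs) # xs"] HS by (auto intro: rec_eval.intros)
  qed
  then show ?thesis unfolding recursive_def by (metis length_Suc_conv)
qed

section \<open>Arithmetic and the pairing function\<close>

lemma recursive_add:
  assumes "recursive k F" "recursive k G"
  shows "recursive k (\<lambda>xs. F xs + G xs)"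
proof -
  have "recursive (Suc 1) (\<lambda>xs. xs ! 0 + xs ! 1)"
    by (rule recursive_primrec[OF recursive_arg[of 0] recursive_Suc[OF recursive_arg[of 1]]]) auto
  then have "recursive 2 (\<lambda>xs. xs ! 0 + xs ! 1)" by (simp only: numeral_2_eq_2 One_nat_def)
  from recursive_comp2[of "(+)", OF this assms] show ?thesis .
qed

lemma recursive_mult:
  assumes "recursive k F" "recursive k G"
  shows "recursive k (\<lambda>xs. F xs * G xs)"
proof -
  have "recursive (Suc 1) (\<lambda>xs. xs ! 0 * xs ! 1)"
    by (rule recursive_primrec[OF recursive_const[of _ 0]
          recursive_add[OF recursive_arg[of 1] recursive_arg[of 2]]]) auto
  then have "recursive 2 (\<lambda>xs. xs ! 0 * xs ! 1)" by (simp only: numeral_2_eq_2 One_nat_def)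
  from recursive_comp2[of "(*)", OF this assms] show ?thesis .
qed

lemma recursive_power:
  assumes "recursive k F"
  shows "recursive k (\<lambda>xs. c ^ F xs)"
proof -
  have "recursive (Suc 0) (\<lambda>xs. c ^ (xs ! 0))"
    by (rule recursive_primrec[OF recursive_const[of _ 1]
          recursive_mult[OF recursive_const[of _ c] recursive_arg[of 1]]]) auto
  then have "recursive 1 (\<lambda>xs. c ^ (xs ! 0))" by simp
  from recursive_comp1[of "(^) c", OF this assms] show ?thesis .
qed

text \<open>The pairing is Cantor's: \<open>prod_encode (m, n) = triangle (m + n) + m\<close>, and
  \<open>triangle\<close> satisfies a primitive recursion.\<close>

lemma recursive_prod_encode:
  assumes "recursive k F" "recursive k G"
  shows "recursive k (\<lambda>xs. prod_encode (F xs, G xs))"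
proof -
  have "recursive (Suc 0) (\<lambda>xs. triangle (xs ! 0))"
    by (rule recursive_primrec[OF recursive_const[of _ 0]
          recursive_add[OF recursive_arg[of 1] recursive_Suc[OF recursive_arg[of 0]]]]) auto
  then have "recursive 1 (\<lambda>xs. triangle (xs ! 0))" by simp
  from recursive_add[OF recursive_comp1[of triangle, OF this recursive_add[OF assms]] assms(1)]
  show ?thesis by (simp add: prod_encode_def)
qed


section \<open>Loop programs\<close>

text \<open>\<open>Loop r c\<close> is an unbounded while loop: it decrements \<open>r\<close>
  before each run of \<open>c\<close>, and \<open>c\<close> may raise \<open>r\<close> again. Fusing
  test and decrement matches the later instruction \<open>Div\<close>, which divides exactly when
  the divisibility test succeeds.\<close>

datatype cmd = Skip | Inc nat | Seq cmd cmd | Loop nat cmd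

inductive exec :: "cmd \<Rightarrow> (nat \<Rightarrow> nat) \<Rightarrow> (nat \<Rightarrow> nat) \<Rightarrow> bool" where
  Skip: "exec Skip \<sigma> \<sigma>"
| Inc: "exec (Inc r) \<sigma> (\<sigma>(r := Suc (\<sigma> r)))"
| Seq: "exec c \<sigma> \<sigma>' \<Longrightarrow> exec d \<sigma>' \<sigma>'' \<Longrightarrow> exec (Seq c d) \<sigma> \<sigma>''"
| Loop_0: "\<sigma> r = 0 \<Longrightarrow> exec (Loop r c) \<sigma> \<sigma>"
| Loop_Suc: "\<sigma> r = Suc n \<Longrightarrow> exec c (\<sigma>(r := n)) \<sigma>' \<Longrightarrow> exec (Loop r c) \<sigma>' \<sigma>'' \<Longrightarrow>
    exec (Loop r c) \<sigma> \<sigma>''"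

section \<open>Transfers between registers\<close>

definition clear :: "nat \<Rightarrow> cmd" where
  "clear r = Loop r Skip"

text \<open>Reading a register by a loop destroys it, so \<open>i\<close> is emptied into both
  \<open>j\<close> and \<open>t\<close> and then restored from \<open>t\<close>.\<close>

definition copy :: "nat \<Rightarrow> nat \<Rightarrow> nat \<Rightarrow> cmd" where
  "copy i j t =
    Seq (Seq (clear j) (clear t)) (Seq (Loop i (Seq (Inc j) (Inc t))) (Loop t (Inc i)))"

lemma exec_clear: "exec (clear r) \<sigma> (\<sigma>(r := 0))"
proof -
  have "exec (Loop r Skip) \<sigma> (\<sigma>(r := 0))" if "\<sigma> r = n" for n
    using that
  proof (induction n arbitrary: \<sigma>)
    case 0
    then have "\<sigma>(r := 0) = \<sigma>" by auto
    then show ?case using 0 by (auto intro: exec.intros)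
  next
    case (Suc n)
    have "exec (Loop r Skip) (\<sigma>(r := n)) ((\<sigma>(r := n))(r := 0))" by (rule Suc.IH) simp
    then have "exec (Loop r Skip) (\<sigma>(r := n)) (\<sigma>(r := 0))" unfolding fun_upd_upd .
    with Suc.prems Skip show ?case by (rule Loop_Suc)
  qed
  then show ?thesis by (simp add: clear_def)
qed

lemma exec_move1:
  assumes "i \<noteq> j"
  shows "exec (Loop i (Inc j)) \<sigma> (\<sigma>(i := 0, j := \<sigma> j + \<sigma> i))"
proof -
  have "exec (Loop i (Inc j)) \<sigma> (\<sigma>(i := 0, j := \<sigma> j + n))" if "\<sigma> i = n" for n
    using that
  proof (induction n arbitrary: \<sigma>)
    case 0
    then have "\<sigma>(i := 0, j := \<sigma> j + 0) = \<sigma>" by auto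
    then show ?case using 0 by (metis Loop_0)
  next
    case (Suc n)
    let ?\<tau> = "\<sigma>(i := n, j := Suc (\<sigma> j))"
    have "exec (Inc j) (\<sigma>(i := n)) ?\<tau>"
      using Inc[of j "\<sigma>(i := n)"] assms by simp
    moreover have "exec (Loop i (Inc j)) ?\<tau> (\<sigma>(i := 0, j := \<sigma> j + Suc n))"
    proof -
      have "?\<tau>(i := 0, j := ?\<tau> j + n) = \<sigma>(i := 0, j := \<sigma> j + Suc n)"
        using assms by (auto simp: fun_eq_iff)
      then show ?thesis using Suc.IH[of ?\<tau>] assms by (metis fun_upd_apply)
    qed
    ultimately show ?case using Suc.prems by (blast intro: Loop_Suc)
  qed
  then show ?thesis by simp
qed

lemma exec_move2:
  assumes "i \<noteq> j" "i \<noteq> t" "j \<noteq> t"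
  shows "exec (Loop i (Seq (Inc j) (Inc t))) \<sigma> (\<sigma>(i := 0, j := \<sigma> j + \<sigma> i, t := \<sigma> t + \<sigma> i))"
proof -
  have "exec (Loop i (Seq (Inc j) (Inc t))) \<sigma> (\<sigma>(i := 0, j := \<sigma> j + n, t := \<sigma> t + n))"
    if "\<sigma> i = n" for n
    using that
  proof (induction n arbitrary: \<sigma>)
    case 0
    then have "\<sigma>(i := 0, j := \<sigma> j + 0, t := \<sigma> t + 0) = \<sigma>" by auto
    then show ?case using 0 by (metis Loop_0)
  next
    case (Suc n)
    let ?\<tau> = "\<sigma>(i := n, j := Suc (\<sigma> j), t := Suc (\<sigma> t))"
    have "exec (Seq (Inc j) (Inc t)) (\<sigma>(i := n)) ?\<tau>"
      using Seq[OF Inc[of j "\<sigma>(i := n)"] Inc[of t]] assms by simp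
    moreover have "exec (Loop i (Seq (Inc j) (Inc t))) ?\<tau>
        (\<sigma>(i := 0, j := \<sigma> j + Suc n, t := \<sigma> t + Suc n))"
    proof -
      have "?\<tau>(i := 0, j := ?\<tau> j + n, t := ?\<tau> t + n) =
          \<sigma>(i := 0, j := \<sigma> j + Suc n, t := \<sigma> t + Suc n)"
        using assms by (auto simp: fun_eq_iff)
      then show ?thesis using Suc.IH[of ?\<tau>] assms by (metis fun_upd_apply)
    qed
    ultimately show ?case using Suc.prems by (blast intro: Loop_Suc)
  qed
  then show ?thesis by simp
qed

lemma exec_copy:
  assumes "i \<noteq> j" "i \<noteq> t" "j \<noteq> t"
  shows "exec (copy i j t) \<sigma> (\<sigma>(j := \<sigma> i, t := 0))"
proof -
  let ?\<tau> = "\<sigma>(j := 0, t := 0)"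
  have "exec (Seq (clear j) (clear t)) \<sigma> ?\<tau>"
    by (rule Seq[OF exec_clear exec_clear])
  moreover have "exec (Loop i (Seq (Inc j) (Inc t))) ?\<tau> (\<sigma>(i := 0, j := \<sigma> i, t := \<sigma> i))"
    using exec_move2[OF assms, of ?\<tau>] assms by (simp add: fun_upd_twist)
  moreover have "exec (Loop t (Inc i)) (\<sigma>(i := 0, j := \<sigma> i, t := \<sigma> i)) (\<sigma>(j := \<sigma> i, t := 0))"
  proof -
    have "(\<sigma>(i := 0, j := \<sigma> i, t := \<sigma> i))(t := 0, i := \<sigma> i) = \<sigma>(j := \<sigma> i, t := 0)"
      using assms by (auto simp: fun_eq_iff)
    then show ?thesis
      using exec_move1[of t i "\<sigma>(i := 0, j := \<sigma> i, t := \<sigma> i)"] assms by simp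
  qed
  ultimately show ?thesis unfolding copy_def by (blast intro: Seq)
qed

section \<open>Loop programs for partial recursive functions\<close>

text \<open>Registers from \<open>b\<close> on are scratch space with arbitrary initial contents.\<close>

definition computes :: "cmd \<Rightarrow> recf \<Rightarrow> nat list \<Rightarrow> nat \<Rightarrow> nat \<Rightarrow> bool" where
  "computes c f ins out b \<longleftrightarrow>
    (\<forall>y \<sigma>. rec_eval f (map \<sigma> ins) y \<longrightarrow>
      (\<exists>\<sigma>'. exec c \<sigma> \<sigma>' \<and> \<sigma>' out = y \<and> (\<forall>r<b. r \<noteq> out \<longrightarrow> \<sigma>' r = \<sigma> r)))"

lemma computesD:
  assumes "computes c f ins out b" "rec_eval f (map \<sigma> ins) y"
  obtains \<sigma>' where "exec c \<sigma> \<sigma>'" "\<sigma>' out = y" "\<And>r. r < b \<Longrightarrow> r \<noteq> out \<Longrightarrow> \<sigma>' r = \<sigma> r"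
  using assms unfolding computes_def by blast

text \<open>All placements of inputs and output are allowed, so that the program of a subfunction
  can be fitted around the registers already in use. The bound \<open>b\<close> can then be raised
  to protect intermediate values.\<close>

definition implementable :: "recf \<Rightarrow> bool" where
  "implementable f \<longleftrightarrow>
    (\<forall>ins out b. set ins \<subseteq> {..<b} \<longrightarrow> out < b \<longrightarrow> out \<notin> set ins \<longrightarrow> (\<exists>c. computes c f ins out b))"

lemma implementableD:
  assumes "implementable f" "set ins \<subseteq> {..<b}" "out < b" "out \<notin> set ins"
  obtains c where "computes c f ins out b"
  using assms unfolding implementable_def by blast

text \<open>The values of \<open>gs\<close> are collected in the registers from \<open>b\<close> on;
  \<open>f\<close> is then run on these with its scratch space moved above them.\<close>

lemma implementable_Comp:
  assumes f: "implementable f" and gs: "\<And>g. g \<in> set gs \<Longrightarrow> implementable g"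
  shows "implementable (Comp f gs)"
  unfolding implementable_def
proof (intro allI impI)
  fix ins :: "nat list" and out b :: nat
  assume ins: "set ins \<subseteq> {..<b}" and out: "out < b" "out \<notin> set ins"
  \<comment> \<open>Induction on the initial segments \<open>hs\<close> of \<open>gs\<close>. Each
    new program gets scratch space only from \<open>b + length gs\<close> on, so it preserves the
    results stored earlier.\<close>
  have "\<exists>c. \<forall>ys \<sigma>. list_all2 (\<lambda>g y. rec_eval g (map \<sigma> ins) y) hs ys \<longrightarrow>
      (\<exists>\<sigma>'. exec c \<sigma> \<sigma>' \<and> map \<sigma>' [b..<b + length hs] = ys \<and> (\<forall>r<b. \<sigma>' r = \<sigma> r))"
    if "set hs \<subseteq> set gs" "length hs \<le> length gs" for hs
    using that
  proof (induction hs rule: rev_induct)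
    case Nil
    show ?case by (intro exI[of _ Skip]) (auto intro: exec.intros)
  next
    case (snoc h hs)
    then obtain c where c: "\<And>ys \<sigma>. list_all2 (\<lambda>g y. rec_eval g (map \<sigma> ins) y) hs ys \<Longrightarrow>
      (\<exists>\<sigma>'. exec c \<sigma> \<sigma>' \<and> map \<sigma>' [b..<b + length hs] = ys \<and> (\<forall>r<b. \<sigma>' r = \<sigma> r))"
      by auto
    obtain d where d: "computes d h ins (b + length hs) (b + length gs)"
      by (rule implementableD[of h ins "b + length gs" "b + length hs"])
        (use gs snoc.prems ins in auto)
    have "\<exists>\<sigma>'. exec (Seq c d) \<sigma> \<sigma>' \<and> map \<sigma>' [b..<b + length (hs @ [h])] = ys \<and> (\<forall>r<b. \<sigma>' r = \<sigma> r)"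
      if "list_all2 (\<lambda>g y. rec_eval g (map \<sigma> ins) y) (hs @ [h]) ys" for ys \<sigma>
    proof -
      from that obtain ys' y where ys: "ys = ys' @ [y]"
        "list_all2 (\<lambda>g y. rec_eval g (map \<sigma> ins) y) hs ys'" "rec_eval h (map \<sigma> ins) y"
        by (auto simp: list_all2_append1 list_all2_Cons1)
      from c[OF ys(2)] obtain \<tau> where \<tau>: "exec c \<sigma> \<tau>" "map \<tau> [b..<b + length hs] = ys'"
        "\<forall>r<b. \<tau> r = \<sigma> r" by blast
      have "map \<tau> ins = map \<sigma> ins" using \<tau>(3) ins by auto
      then obtain \<sigma>' where \<sigma>': "exec d \<tau> \<sigma>'" "\<sigma>' (b + length hs) = y"
        "\<And>r. r < b + length gs \<Longrightarrow> r \<noteq> b + length hs \<Longrightarrow> \<sigma>' r = \<tau> r"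
        using computesD[OF d, of \<tau> y] ys(3) by metis
      have "map \<sigma>' [b..<b + length hs] = map \<tau> [b..<b + length hs]"
        using \<sigma>'(3) snoc.prems(2) by auto
      then have "map \<sigma>' [b..<b + length (hs @ [h])] = ys" using \<tau>(2) \<sigma>'(2) ys(1) by simp
      moreover have "\<forall>r<b. \<sigma>' r = \<sigma> r" using \<tau>(3) \<sigma>'(3) by auto
      ultimately show ?thesis using Seq[OF \<tau>(1) \<sigma>'(1)] by blast
    qed
    then show ?case by blast
  qed
  from this[of gs] obtain c where
    c: "\<And>ys \<sigma>. list_all2 (\<lambda>g y. rec_eval g (map \<sigma> ins) y) gs ys \<Longrightarrow>
      (\<exists>\<sigma>'. exec c \<sigma> \<sigma>' \<and> map \<sigma>' [b..<b + length gs] = ys \<and> (\<forall>r<b. \<sigma>' r = \<sigma> r))"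
    by auto
  obtain d where d: "computes d f [b..<b + length gs] out (b + length gs)"
    by (rule implementableD[OF f, of "[b..<b + length gs]" "b + length gs" out]) (use out in auto)
  have "computes (Seq c d) (Comp f gs) ins out b"
    unfolding computes_def
  proof (intro allI impI)
    fix y \<sigma> assume "rec_eval (Comp f gs) (map \<sigma> ins) y"
    then obtain ys where ys: "list_all2 (\<lambda>g y. rec_eval g (map \<sigma> ins) y) gs ys" "rec_eval f ys y"
      by (rule rec_eval_CompE)
    from c[OF ys(1)] obtain \<tau> where \<tau>: "exec c \<sigma> \<tau>" "map \<tau> [b..<b + length gs] = ys"
      "\<forall>r<b. \<tau> r = \<sigma> r" by blast
    obtain \<sigma>' where "exec d \<tau> \<sigma>'" "\<sigma>' out = y"
      "\<And>r. r < b + length gs \<Longrightarrow> r \<noteq> out \<Longrightarrow> \<sigma>' r = \<tau> r"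
      using computesD[OF d, of \<tau> y] ys(2) \<tau>(2) by metis
    then show "\<exists>\<sigma>'. exec (Seq c d) \<sigma> \<sigma>' \<and> \<sigma>' out = y \<and> (\<forall>r<b. r \<noteq> out \<longrightarrow> \<sigma>' r = \<sigma> r)"
      using \<tau> by (intro exI[of _ \<sigma>']) (auto intro: Seq)
  qed
  then show "\<exists>c. computes c (Comp f gs) ins out b" by blast
qed

text \<open>A value at \<open>Suc n\<close> can only be derived from a value at \<open>n\<close>, so
  definedness passes downwards. This supplies the values needed at every round of the loop
  below.\<close>

lemma rec_eval_PrimRec_le:
  assumes "k \<le> n" "rec_eval (PrimRec f g) (n # xs) y"
  shows "\<exists>w. rec_eval (PrimRec f g) (k # xs) w"
  using assms
proof (induction rule: inc_induct)
  case (step k)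
  then show ?case by (blast elim: rec_eval_PrimRec_SucE)
qed blast

lemma implementable_PrimRec:
  assumes f: "implementable f" and g: "implementable g"
  shows "implementable (PrimRec f g)"
  unfolding implementable_def
proof (intro allI impI)
  fix ins' :: "nat list" and out b :: nat
  assume ins': "set ins' \<subseteq> {..<b}" and out: "out < b" "out \<notin> set ins'"
  show "\<exists>c. computes c (PrimRec f g) ins' out b"
  proof (cases ins')
    case Nil
    \<comment> \<open>Without a recursion argument the function is undefined, so any program will
      do.\<close>
    have "\<not> rec_eval (PrimRec f g) [] y" for y by (auto elim: rec_eval.cases)
    then show ?thesis using Nil by (auto simp: computes_def)
  next
    case (Cons i ins)
    have ins: "set ins \<subseteq> {..<b}" "out \<notin> set ins" and i: "i < b" "i \<noteq> out"
      using ins' out Cons by auto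
    \<comment> \<open>\<open>?n\<close> counts the rounds done and \<open>?m\<close> those left. The
      value of \<open>g\<close> first goes to \<open>?new\<close>, because \<open>out\<close>,
      holding the previous value, is itself an input of \<open>g\<close>.\<close>
    let ?n = b and ?m = "b + 1" and ?new = "b + 2" and ?t = "b + 3" and ?b = "b + 4"
    obtain c where c: "computes c f ins out ?b"
      using implementableD[OF f, of ins ?b out] ins out by fastforce
    obtain d where d: "computes d g (?n # out # ins) ?new ?b"
      using implementableD[OF g, of "?n # out # ins" ?b ?new] ins out by fastforce
    let ?body = "Seq (Seq d (copy ?new out ?t)) (Inc ?n)"
    let ?prog = "Seq (Seq c (Seq (copy i ?m ?t) (clear ?n))) (Loop ?m ?body)"
    have "computes ?prog (PrimRec f g) ins' out b"
      unfolding computes_def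
    proof (intro allI impI)
      fix y \<sigma> assume ev: "rec_eval (PrimRec f g) (map \<sigma> ins') y"
      let ?xs = "map \<sigma> ins"
      \<comment> \<open>The loop invariant: the two counters add up to the recursion argument
        \<open>\<sigma> i\<close>, and \<open>out\<close> holds the value of the recursion at
        \<open>\<tau> ?n\<close>.\<close>
      have loop: "\<exists>\<sigma>'. exec (Loop ?m ?body) \<tau> \<sigma>' \<and> \<sigma>' out = y \<and> (\<forall>r<b. r \<noteq> out \<longrightarrow> \<sigma>' r = \<sigma> r)"
        if "\<tau> ?m = m" "\<tau> ?n + m = \<sigma> i" "rec_eval (PrimRec f g) (\<tau> ?n # ?xs) (\<tau> out)"
          "\<forall>r<b. r \<noteq> out \<longrightarrow> \<tau> r = \<sigma> r" for m \<tau>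
        using that
      proof (induction m arbitrary: \<tau>)
        case 0
        then have "\<tau> out = y"
          using rec_eval_deterministic ev Cons by simp
        then show ?case using 0 by (blast intro: Loop_0)
      next
        case (Suc m)
        let ?\<tau> = "\<tau>(?m := m)"
        have le: "Suc (\<tau> ?n) \<le> \<sigma> i" using Suc.prems by simp
        obtain z where z: "rec_eval (PrimRec f g) (Suc (\<tau> ?n) # ?xs) z"
          using rec_eval_PrimRec_le[OF le, of f g ?xs y] ev Cons by auto
        then have "rec_eval g (\<tau> ?n # \<tau> out # ?xs) z"
          using Suc.prems(3) rec_eval_deterministic by (blast elim: rec_eval_PrimRec_SucE)
        moreover have "map ?\<tau> (?n # out # ins) = \<tau> ?n # \<tau> out # ?xs"
          using Suc.prems(4) ins out by (auto intro!: map_cong)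
        ultimately obtain \<tau>1 where \<tau>1: "exec d ?\<tau> \<tau>1" "\<tau>1 ?new = z"
          "\<And>r. r < ?b \<Longrightarrow> r \<noteq> ?new \<Longrightarrow> \<tau>1 r = ?\<tau> r"
          using computesD[OF d, of ?\<tau> z] by metis
        let ?\<tau>2 = "\<tau>1(out := z, ?t := 0)"
        let ?\<tau>3 = "?\<tau>2(?n := Suc (?\<tau>2 ?n))"
        have "exec (copy ?new out ?t) \<tau>1 ?\<tau>2"
          using exec_copy[of ?new out ?t \<tau>1] \<tau>1(2) out by simp
        then have body: "exec ?body ?\<tau> ?\<tau>3" by (intro Seq[OF Seq[OF \<tau>1(1)] Inc])
        have "\<exists>\<sigma>'. exec (Loop ?m ?body) ?\<tau>3 \<sigma>' \<and> \<sigma>' out = y \<and> (\<forall>r<b. r \<noteq> out \<longrightarrow> \<sigma>' r = \<sigma> r)"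
          by (rule Suc.IH) (use \<tau>1(3) z Suc.prems out in auto)
        then show ?case using Loop_Suc[OF Suc.prems(1) body] by blast
      qed
      obtain w where w: "rec_eval (PrimRec f g) (0 # ?xs) w"
        using rec_eval_PrimRec_le[OF le0, of f g "\<sigma> i" ?xs y] ev Cons by auto
      then have "rec_eval f ?xs w" by (rule rec_eval_PrimRec_0E)
      then obtain \<tau>1 where \<tau>1: "exec c \<sigma> \<tau>1" "\<tau>1 out = w"
        "\<And>r. r < ?b \<Longrightarrow> r \<noteq> out \<Longrightarrow> \<tau>1 r = \<sigma> r"
        using computesD[OF c] by metis
      let ?\<tau> = "\<tau>1(?m := \<tau>1 i, ?t := 0, ?n := 0)"
      have "exec (Seq (copy i ?m ?t) (clear ?n)) \<tau>1 ?\<tau>"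
        using i by (intro Seq[OF exec_copy exec_clear]) auto
      then have start: "exec (Seq c (Seq (copy i ?m ?t) (clear ?n))) \<sigma> ?\<tau>" by (rule Seq[OF \<tau>1(1)])
      have "\<exists>\<sigma>'. exec (Loop ?m ?body) ?\<tau> \<sigma>' \<and> \<sigma>' out = y \<and> (\<forall>r<b. r \<noteq> out \<longrightarrow> \<sigma>' r = \<sigma> r)"
        by (rule loop[of _ "\<sigma> i"]) (use \<tau>1 w i out in auto)
      then show "\<exists>\<sigma>'. exec ?prog \<sigma> \<sigma>' \<and> \<sigma>' out = y \<and> (\<forall>r<b. r \<noteq> out \<longrightarrow> \<sigma>' r = \<sigma> r)"
        using Seq[OF start] by blast
    qed
    then show ?thesis by blast
  qed
qed

text \<open>The search variable lives in \<open>out\<close>, and the current value of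
  \<open>f\<close> in register \<open>b\<close>, which controls the loop. That the loop decrements
  \<open>b\<close> is harmless, since the body recomputes it.\<close>

lemma implementable_Mu:
  assumes f: "implementable f"
  shows "implementable (Mu f)"
  unfolding implementable_def
proof (intro allI impI)
  fix ins :: "nat list" and out b :: nat
  assume ins: "set ins \<subseteq> {..<b}" and out: "out < b" "out \<notin> set ins"
  obtain c where c: "computes c f (out # ins) b (b + 1)"
    using implementableD[OF f, of "out # ins" "b + 1" b] ins out by fastforce
  let ?body = "Seq (Inc out) c"
  let ?prog = "Seq (Seq (clear out) c) (Loop b ?body)"
  have "computes ?prog (Mu f) ins out b"
    unfolding computes_def
  proof (intro allI impI)
    fix y \<sigma> assume "rec_eval (Mu f) (map \<sigma> ins) y"
    then have y: "rec_eval f (y # map \<sigma> ins) 0"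
      "\<And>m. m < y \<Longrightarrow> \<exists>r. rec_eval f (m # map \<sigma> ins) (Suc r)"
      by (auto elim: rec_eval_MuE)
    have eval: "\<exists>w. rec_eval f (k # map \<sigma> ins) w" if "k \<le> y" for k
      using y that by (metis le_neq_implies_less)
    have loop: "\<exists>\<sigma>'. exec (Loop b ?body) \<tau> \<sigma>' \<and> \<sigma>' out = y \<and> (\<forall>r<b. r \<noteq> out \<longrightarrow> \<sigma>' r = \<sigma> r)"
      if "\<tau> out \<le> y" "rec_eval f (\<tau> out # map \<sigma> ins) (\<tau> b)" "\<forall>r<b. r \<noteq> out \<longrightarrow> \<tau> r = \<sigma> r" for \<tau>
      using that
    proof (induction "y - \<tau> out" arbitrary: \<tau>)
      case 0
      then have "\<tau> out = y" by simp
      moreover have "\<tau> b = 0" using 0 y(1) rec_eval_deterministic \<open>\<tau> out = y\<close> by blast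
      ultimately show ?case using 0 by (blast intro: Loop_0)
    next
      case (Suc k)
      then have lt: "\<tau> out < y" by simp
      \<comment> \<open>Below \<open>y\<close> the values of \<open>f\<close> are successors, so by
        determinism the loop cannot stop early.\<close>
      then obtain n where n: "\<tau> b = Suc n"
        using y(2) Suc.prems(2) rec_eval_deterministic by blast
      let ?\<tau> = "\<tau>(b := n, out := Suc (\<tau> out))"
      have inc: "exec (Inc out) (\<tau>(b := n)) ?\<tau>" using Inc[of out "\<tau>(b := n)"] out by simp
      have "map ?\<tau> (out # ins) = Suc (\<tau> out) # map \<sigma> ins"
        using Suc.prems(3) ins out by (auto intro!: map_cong)
      moreover obtain w where "rec_eval f (Suc (\<tau> out) # map \<sigma> ins) w"
        using eval[of "Suc (\<tau> out)"] lt by auto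
      ultimately obtain \<tau>' where \<tau>': "exec c ?\<tau> \<tau>'" "rec_eval f (Suc (\<tau> out) # map \<sigma> ins) (\<tau>' b)"
        "\<And>r. r < b + 1 \<Longrightarrow> r \<noteq> b \<Longrightarrow> \<tau>' r = ?\<tau> r"
        using computesD[OF c, of ?\<tau> w] by metis
      have \<tau>'_out: "\<tau>' out = Suc (\<tau> out)" using \<tau>'(3)[of out] out by simp
      have "\<exists>\<sigma>'. exec (Loop b ?body) \<tau>' \<sigma>' \<and> \<sigma>' out = y \<and> (\<forall>r<b. r \<noteq> out \<longrightarrow> \<sigma>' r = \<sigma> r)"
        by (rule Suc.hyps(1)) (use \<tau>' \<tau>'_out Suc lt in auto)
      then show ?case using Loop_Suc[OF n Seq[OF inc \<tau>'(1)]] by blast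
    qed
    let ?\<tau> = "\<sigma>(out := 0)"
    have "map ?\<tau> (out # ins) = 0 # map \<sigma> ins" using out by auto
    moreover obtain w where "rec_eval f (0 # map \<sigma> ins) w" using eval[of 0] by auto
    ultimately obtain \<tau>' where \<tau>': "exec c ?\<tau> \<tau>'" "rec_eval f (0 # map \<sigma> ins) (\<tau>' b)"
      "\<And>r. r < b + 1 \<Longrightarrow> r \<noteq> b \<Longrightarrow> \<tau>' r = ?\<tau> r"
      using computesD[OF c, of ?\<tau> w] by metis
    have "\<exists>\<sigma>'. exec (Loop b ?body) \<tau>' \<sigma>' \<and> \<sigma>' out = y \<and> (\<forall>r<b. r \<noteq> out \<longrightarrow> \<sigma>' r = \<sigma> r)"
      by (rule loop) (use \<tau>' out in auto)
    then show "\<exists>\<sigma>'. exec ?prog \<sigma> \<sigma>' \<and> \<sigma>' out = y \<and> (\<forall>r<b. r \<noteq> out \<longrightarrow> \<sigma>' r = \<sigma> r)"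
      using Seq[OF Seq[OF exec_clear \<tau>'(1)]] by blast
  qed
  then show "\<exists>c. computes c (Mu f) ins out b" by blast
qed

lemma implementable_all: "implementable f"
proof (induction f)
  case Zero
  have "computes (clear out) Zero ins out b" for ins out b
    unfolding computes_def
    by (auto elim!: rec_eval_ZeroE intro!: exI[of _ "_(out := 0)"] exec_clear)
  then show ?case unfolding implementable_def by blast
next
  case Succ
  show ?case unfolding implementable_def
  proof (intro allI impI)
    fix ins :: "nat list" and out b :: nat
    assume ins: "set ins \<subseteq> {..<b}" and out: "out < b" "out \<notin> set ins"
    \<comment> \<open>\<open>Succ\<close> is defined on one-element lists only; for other lists of
      inputs the choice of \<open>hd ins\<close> does not matter.\<close>
    have "\<exists>\<sigma>'. exec (Seq (copy (hd ins) out b) (Inc out)) \<sigma> \<sigma>' \<and> \<sigma>' out = y \<and>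
        (\<forall>r<b. r \<noteq> out \<longrightarrow> \<sigma>' r = \<sigma> r)" if "rec_eval Succ (map \<sigma> ins) y" for \<sigma> y
    proof -
      from that obtain i where i: "ins = [i]" "y = Suc (\<sigma> i)" by (auto elim!: rec_eval_SuccE)
      have "exec (copy i out b) \<sigma> (\<sigma>(out := \<sigma> i, b := 0))"
        using ins out i by (intro exec_copy) auto
      from Seq[OF this Inc[of out]] show ?thesis
        using i out by (intro exI[of _ "\<sigma>(out := \<sigma> i, b := 0, out := Suc (\<sigma> i))"]) auto
    qed
    then show "\<exists>c. computes c Succ ins out b" unfolding computes_def by blast
  qed
next
  case (Proj i)
  show ?case unfolding implementable_def
  proof (intro allI impI)
    fix ins :: "nat list" and out b :: nat
    assume ins: "set ins \<subseteq> {..<b}" and out: "out < b" "out \<notin> set ins"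
    have "\<exists>\<sigma>'. exec (copy (ins ! i) out b) \<sigma> \<sigma>' \<and> \<sigma>' out = y \<and>
        (\<forall>r<b. r \<noteq> out \<longrightarrow> \<sigma>' r = \<sigma> r)" if "rec_eval (Proj i) (map \<sigma> ins) y" for \<sigma> y
    proof -
      from that have i: "i < length ins" "y = \<sigma> (ins ! i)" by (auto elim!: rec_eval_ProjE)
      then have "ins ! i \<in> set ins" by simp
      then have "exec (copy (ins ! i) out b) \<sigma> (\<sigma>(out := \<sigma> (ins ! i), b := 0))"
        using ins out by (intro exec_copy) auto
      then show ?thesis using i out by (intro exI[of _ "\<sigma>(out := \<sigma> (ins ! i), b := 0)"]) auto
    qed
    then show "\<exists>c. computes c (Proj i) ins out b" unfolding computes_def by blast
  qed
qed (use implementable_Comp implementable_PrimRec implementable_Mu in auto)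


section \<open>Multiplication-division machines\<close>

datatype instr = Mul nat nat | Div nat nat nat

fun exec_instr :: "instr \<Rightarrow> int \<Rightarrow> nat \<times> int" where
  "exec_instr (Mul p j) v = (j, int p * v)"
| "exec_instr (Div p j k) v = (if int p dvd v then (j, v div int p) else (k, v))"

text \<open>Steps are total, as the transition function of a deterministic automaton must be.
  Halting is therefore the reaching of a designated address.\<close>

definition step :: "instr list \<Rightarrow> nat \<times> int \<Rightarrow> nat \<times> int" where
  "step P = (\<lambda>(i, v). exec_instr (P ! i) v)"

definition reaches :: "instr list \<Rightarrow> nat \<times> int \<Rightarrow> nat \<times> int \<Rightarrow> bool" where
  "reaches P a b \<longleftrightarrow> (\<exists>n. (step P ^^ n) a = b)"

lemma reaches_refl: "reaches P a a"
  unfolding reaches_def by (rule exI[of _ 0]) simp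

lemma reaches_step: "step P a = b \<Longrightarrow> reaches P a b"
  unfolding reaches_def by (rule exI[of _ 1]) simp

lemma reaches_trans: "reaches P a b \<Longrightarrow> reaches P b c \<Longrightarrow> reaches P a c"
  unfolding reaches_def by (metis funpow_add comp_apply)

section \<open>Registers as exponents of primes\<close>

definition nth_prime :: "nat \<Rightarrow> nat" where
  "nth_prime = enumerate {p. prime p}"

lemma prime_nth_prime: "prime (nth_prime r)"
  using enumerate_in_set[OF primes_infinite] by (auto simp: nth_prime_def)

lemma prime_int_nth_prime: "prime (int (nth_prime r))"
  using prime_nth_prime by simp

lemma nth_prime_eq_iff: "nth_prime r = nth_prime s \<longleftrightarrow> r = s"
  using strict_mono_enumerate[OF primes_infinite] strict_mono_eq unfolding nth_prime_def by blast

text \<open>This is a Goedel numbering of stores. Zero is excluded: every prime divides it although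
  its multiplicities are 0, so divisibility would no longer test whether a register is
  positive.\<close>

definition represents :: "int \<Rightarrow> (nat \<Rightarrow> nat) \<Rightarrow> bool" where
  "represents v \<sigma> \<longleftrightarrow> v \<noteq> 0 \<and> (\<forall>r. multiplicity (int (nth_prime r)) v = \<sigma> r)"

lemma multiplicity_nth_prime_mult:
  assumes "v \<noteq> 0"
  shows "multiplicity (int (nth_prime s)) (int (nth_prime r) * v) =
    (if s = r then 1 else 0) + multiplicity (int (nth_prime s)) v"
proof -
  have "multiplicity (int (nth_prime s)) (int (nth_prime r)) = (if s = r then 1 else 0)"
    using prime_int_nth_prime[of s] prime_int_nth_prime[of r]
    by (auto simp: prime_multiplicity_other nth_prime_eq_iff multiplicity_prime)
  moreover have "int (nth_prime r) \<noteq> 0" using prime_nth_prime[of r] by (auto simp: prime_gt_0_nat)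
  ultimately show ?thesis
    using assms prime_int_nth_prime[of s]
    by (simp add: prime_elem_multiplicity_mult_distrib prime_imp_prime_elem)
qed

lemma represents_mult:
  assumes "represents v \<sigma>"
  shows "represents (int (nth_prime r) * v) (\<sigma>(r := Suc (\<sigma> r)))"
  using assms prime_gt_0_nat[OF prime_nth_prime[of r]]
  by (auto simp: represents_def multiplicity_nth_prime_mult)

lemma represents_power_mult:
  assumes "represents v \<sigma>"
  shows "represents (int (nth_prime r) ^ n * v) (\<sigma>(r := \<sigma> r + n))"
proof (induction n)
  case 0
  then show ?case using assms by simp
next
  case (Suc n)
  have "(\<sigma>(r := \<sigma> r + n))(r := Suc ((\<sigma>(r := \<sigma> r + n)) r)) = \<sigma>(r := \<sigma> r + Suc n)"
    by (simp add: fun_eq_iff)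
  with represents_mult[OF Suc, of r] show ?case by (metis mult.assoc power_Suc)
qed

lemma represents_dvd_iff:
  assumes "represents v \<sigma>"
  shows "int (nth_prime r) dvd v \<longleftrightarrow> \<sigma> r \<noteq> 0"
proof -
  have "\<not> is_unit (int (nth_prime r))" "v \<noteq> 0"
    using prime_int_nth_prime[of r] assms not_prime_unit by (auto simp: represents_def)
  then have "multiplicity (int (nth_prime r)) v > 0 \<longleftrightarrow> int (nth_prime r) dvd v"
    by (simp add: multiplicity_gt_zero_iff)
  then show ?thesis using assms by (auto simp: represents_def)
qed

lemma represents_div:
  assumes "represents v \<sigma>" "\<sigma> r = Suc n"
  shows "represents (v div int (nth_prime r)) (\<sigma>(r := n))"
proof -
  obtain w where w: "v = int (nth_prime r) * w"
    using represents_dvd_iff[OF assms(1), of r] assms(2) by (auto elim: dvdE)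
  have "w \<noteq> 0" using assms(1) w by (auto simp: represents_def)
  have "multiplicity (int (nth_prime s)) w = (\<sigma>(r := n)) s" for s
  proof -
    have "\<sigma> s = (if s = r then 1 else 0) + multiplicity (int (nth_prime s)) w"
      using assms(1) w multiplicity_nth_prime_mult[OF \<open>w \<noteq> 0\<close>, of s r] by (auto simp: represents_def)
    then show ?thesis using assms(2) by (auto split: if_splits)
  qed
  then show ?thesis
    using w \<open>w \<noteq> 0\<close> prime_gt_0_nat[OF prime_nth_prime[of r]] by (simp add: represents_def)
qed

section \<open>Translation of loop programs into machine code\<close>

text \<open>\<open>compile s c\<close> is the code of \<open>c\<close> at address \<open>s\<close>, left at the address following it.\<close>

fun compile :: "nat \<Rightarrow> cmd \<Rightarrow> instr list" where
  "compile s Skip = []"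
| "compile s (Inc r) = [Mul (nth_prime r) (Suc s)]"
| "compile s (Seq c d) = compile s c @ compile (s + length (compile s c)) d"
| "compile s (Loop r c) =
    Div (nth_prime r) (Suc s) (s + length (compile (Suc s) c) + 2) # compile (Suc s) c @ [Mul 1 s]"

text \<open>Jump targets are absolute, so the code is considered inside an arbitrary context
  \<open>A\<close>, \<open>B\<close> whose first part has the starting address as its length. The
  instruction \<open>Mul 1 s\<close> serves as a jump to \<open>s\<close>.\<close>

lemma compile_correct:
  assumes "exec c \<sigma> \<sigma>'" "P = A @ compile (length A) c @ B" "represents v \<sigma>"
  shows "\<exists>v'. represents v' \<sigma>' \<and>
    reaches P (length A, v) (length A + length (compile (length A) c), v')"
  using assms
proof (induction arbitrary: A B v rule: exec.induct)
  case (Skip \<sigma>)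
  then show ?case by (auto intro: reaches_refl)
next
  case (Inc r \<sigma>)
  have "step P (length A, v) = (Suc (length A), int (nth_prime r) * v)"
    using Inc.prems(1) by (simp add: step_def)
  then have "reaches P (length A, v) (Suc (length A), int (nth_prime r) * v)" by (rule reaches_step)
  then show ?case using represents_mult[OF Inc.prems(2), of r]
    by (intro exI[of _ "int (nth_prime r) * v"]) (simp del: fun_upd_apply)
next
  case (Seq c \<sigma> \<sigma>' d \<sigma>'')
  let ?c = "compile (length A) c"
  obtain v1 where v1: "represents v1 \<sigma>'" "reaches P (length A, v) (length A + length ?c, v1)"
    using Seq.IH(1)[of A _ v] Seq.prems by auto
  obtain v2 where v2: "represents v2 \<sigma>''" "reaches P (length (A @ ?c), v1)
      (length (A @ ?c) + length (compile (length (A @ ?c)) d), v2)"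
    using Seq.IH(2)[of "A @ ?c" B v1] Seq.prems(1) v1(1) by auto
  have "reaches P (length A, v) (length A + length (compile (length A) (Seq c d)), v2)"
    using reaches_trans[OF v1(2)] v2(2) by (simp add: add.assoc)
  then show ?case using v2(1) by blast
next
  case (Loop_0 \<sigma> r c)
  have "step P (length A, v) = (length A + length (compile (Suc (length A)) c) + 2, v)"
    using Loop_0 represents_dvd_iff[OF Loop_0.prems(2), of r] by (simp add: step_def)
  then have "reaches P (length A, v) (length A + length (compile (length A) (Loop r c)), v)"
    by (intro reaches_step) simp
  then show ?case using Loop_0.prems(2) by blast
next
  case (Loop_Suc \<sigma> r n c \<sigma>' \<sigma>'')
  let ?c = "compile (Suc (length A)) c"
  let ?test = "Div (nth_prime r) (Suc (length A)) (length A + length ?c + 2)"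
  \<comment> \<open>The body of the loop is the middle of another splitting of \<open>P\<close>,
    with the test on its left and the jump back on its right.\<close>
  have P: "P = (A @ [?test]) @ ?c @ Mul 1 (length A) # B" using Loop_Suc.prems(1) by simp
  have "step P (length A, v) = (Suc (length A), v div int (nth_prime r))"
    using Loop_Suc represents_dvd_iff[OF Loop_Suc.prems(2), of r] by (simp add: step_def)
  then have 1: "reaches P (length A, v) (Suc (length A), v div int (nth_prime r))"
    by (rule reaches_step)
  obtain v1 where v1: "represents v1 \<sigma>'"
    "reaches P (Suc (length A), v div int (nth_prime r)) (Suc (length A) + length ?c, v1)"
    using Loop_Suc.IH(1)[of "A @ [?test]" "Mul 1 (length A) # B" "v div int (nth_prime r)",
        OF _ represents_div[OF Loop_Suc.prems(2) Loop_Suc.hyps(1)]] P by auto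
  have "P ! (Suc (length A) + length ?c) = Mul 1 (length A)"
    unfolding P by (simp add: nth_append)
  then have 2: "reaches P (Suc (length A) + length ?c, v1) (length A, v1)"
    by (intro reaches_step) (simp add: step_def)
  obtain v2 where "represents v2 \<sigma>''"
    "reaches P (length A, v1) (length A + length (compile (length A) (Loop r c)), v2)"
    using Loop_Suc.IH(2)[OF Loop_Suc.prems(1) v1(1)] by blast
  then show ?case using 1 v1(2) 2 reaches_trans by blast
qed

text \<open>The bounds on the targets keep the automaton inside its state set; positive factors make
  \<open>div\<close> expressible by the formula for \<open>Div\<close>.\<close>

fun instr_bounded :: "nat \<Rightarrow> instr \<Rightarrow> bool" where
  "instr_bounded m (Mul p j) \<longleftrightarrow> p > 0 \<and> j < m"
| "instr_bounded m (Div p j k) \<longleftrightarrow> p > 0 \<and> j < m \<and> k < m"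

text \<open>The inequality is strict because the address just after the code is itself a possible
  target.\<close>

lemma instr_bounded_compile:
  "x \<in> set (compile s c) \<Longrightarrow> s + length (compile s c) < m \<Longrightarrow> instr_bounded m x"
proof (induction c arbitrary: s)
  case (Inc r)
  then show ?case using prime_gt_0_nat[OF prime_nth_prime[of r]] by auto
next
  case (Loop r c)
  then show ?case using prime_gt_0_nat[OF prime_nth_prime[of r]] Loop.IH[of "Suc s"] by auto
next
  case (Seq c d)
  then show ?case using Seq.IH(1)[of s] Seq.IH(2)[of "s + length (compile s c)"] by auto
qed simp


section \<open>The automaton of a machine\<close>

primrec tmul :: "nat \<Rightarrow> pterm \<Rightarrow> pterm" where
  "tmul 0 t = Const 0"
| "tmul (Suc n) t = Add t (tmul n t)"

lemma tval_tmul: "tval e (tmul n t) = int n * tval e t"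
  by (induction n) (auto simp: algebra_simps)

lemma tvars_below_tmul: "tvars_below m t \<Longrightarrow> tvars_below m (tmul n t)"
  by (induction n) auto

definition false_form :: pform where
  "false_form = Eq (Const 0) (Const 1)"

definition or_form :: "pform \<Rightarrow> pform \<Rightarrow> pform" where
  "or_form \<phi> \<psi> = Neg (And (Neg \<phi>) (Neg \<psi>))"

text \<open>The variables 0, 1, 2 are the old state, the letter and the new state.\<close>

fun step_form :: "instr \<Rightarrow> nat \<Rightarrow> pform" where
  "step_form (Mul p j') j =
    (if j = j' then Eq (Add (Var 2) (tmul p (Var 1))) (Add (tmul p (Var 0)) (Var 1)) else false_form)"
| "step_form (Div p j' k) j =
    or_form
      (if j = j' then Eq (Add (tmul p (Var 2)) (Var 1)) (Add (Var 0) (tmul p (Var 1))) else false_form)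
      (if j = k then And (Eq (Var 2) (Var 0)) (Neg (Ex (Eq (Add (tmul p (Var 0)) (Var 2)) (Var 1))))
       else false_form)"

lemma fvars_below_step_form: "fvars_below 3 (step_form I j)"
  by (cases I) (auto simp: tvars_below_tmul false_form_def or_form_def)

text \<open>The machine integer is the difference of state and letter. As terms have no subtraction,
  the equations are rearranged: \<open>y - a = p * (x - a)\<close> becomes
  \<open>y + p * a = p * x + a\<close>. Under \<open>Ex\<close> the old state and the letter are the
  variables 1 and 2.\<close>

lemma sat_step_form:
  assumes "instr_bounded m I"
  shows "sat e (step_form I j) \<longleftrightarrow> exec_instr I (e 0 - e 1) = (j, e 2 - e 1)"
proof (cases I)
  case (Mul p j')
  then show ?thesis by (auto simp: tval_tmul false_form_def algebra_simps)
next
  case (Div p j' k)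
  then have p: "p > 0" using assms by simp
  have "int p * e 2 + e 1 = e 0 + int p * e 1 \<longleftrightarrow> e 0 - e 1 = int p * (e 2 - e 1)"
    by (auto simp: algebra_simps)
  also have "\<dots> \<longleftrightarrow> int p dvd e 0 - e 1 \<and> (e 0 - e 1) div int p = e 2 - e 1"
    using p by (auto elim!: dvdE)
  finally have 1: "int p * e 2 + e 1 = e 0 + int p * e 1 \<longleftrightarrow>
    int p dvd e 0 - e 1 \<and> (e 0 - e 1) div int p = e 2 - e 1" .
  have 2: "(\<exists>d. int p * d + e 1 = e 0) \<longleftrightarrow> int p dvd e 0 - e 1"
    unfolding dvd_def by (metis add_diff_cancel_right' diff_add_cancel)
  show ?thesis
    using 1 2 Div by (auto simp: tval_tmul false_form_def or_form_def numeral_2_eq_2)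
qed

text \<open>Here the letter is variable 0 and the new state variable 1, since the one-element orbit
  of the initial state contributes no coordinate.\<close>

definition init_form :: "nat \<Rightarrow> pform" where
  "init_form V = Eq (Var 1) (Add (Var 0) (Const (int V)))"

text \<open>Orbit 0 is the initial state; orbit \<open>Suc i\<close> belongs to the machine state \<open>i\<close>.  The machine
  starts in state 1 with the integer \<open>V\<close>, and it halts in state 0.\<close>

definition machine_orbits :: "instr list \<Rightarrow> nat list" where
  "machine_orbits P = 1 # replicate (length P) 0"

text \<open>A state \<open>(Suc i, x)\<close> read with the letter \<open>a\<close> stands for the
  configuration \<open>(i, x - a)\<close>. Translations preserve this difference, so any step
  function becomes equivariant. The first letter loads \<open>V\<close> and enters orbit 2, that of
  machine state 1.\<close>

definition machine_delta :: "instr list \<Rightarrow> nat \<Rightarrow> nat \<times> int \<Rightarrow> int \<Rightarrow> nat \<times> int" where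
  "machine_delta P V = (\<lambda>(i, x) a. case i of
      0 \<Rightarrow> (2, a + int V)
    | Suc i \<Rightarrow> (case step P (i, x - a) of (j, w) \<Rightarrow> (Suc j, a + w)))"

definition machine_dfa :: "instr list \<Rightarrow> nat \<Rightarrow> (nat \<times> int, int) dfa" where
  "machine_dfa P V =
    \<lparr>states = Zmod_sum (machine_orbits P), state_act = Zmod_sum_act (machine_orbits P),
     alphabet = UNIV, letter_act = (+), delta = machine_delta P V,
     initial = (0, 0), accepting = {1} \<times> UNIV\<rparr>"

text \<open>\<open>V\<close> occurs only in the entry from orbit 0 to orbit 2; everything else
  depends on \<open>P\<close> alone. Accepting is orbit 1, that of machine state 0.\<close>

definition machine_code :: "instr list \<Rightarrow> nat \<Rightarrow> dfa_code" where
  "machine_code P V = (machine_orbits P, 0, [1],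
    ([false_form] # [false_form] # [init_form V] # replicate (length P - 2) [false_form]) #
    map (\<lambda>I. [false_form] # map (\<lambda>j. [step_form I j]) [0..<length P]) P)"

definition well_formed :: "instr list \<Rightarrow> bool" where
  "well_formed P \<longleftrightarrow> length P \<ge> 2 \<and> (\<forall>I\<in>set P. instr_bounded (length P) I)"

section \<open>Orbits and equivariance\<close>

lemma Zmod_sum_machine_orbits:
  "(i, x) \<in> Zmod_sum (machine_orbits P) \<longleftrightarrow> i = 0 \<and> x = 0 \<or> 0 < i \<and> i \<le> length P"
  by (cases i) (auto simp: Zmod_sum_def Zmod_def machine_orbits_def)

lemma Zmod_sum_act_machine_orbits:
  "(i, x) \<in> Zmod_sum (machine_orbits P) \<Longrightarrow>
    Zmod_sum_act (machine_orbits P) z (i, x) = (i, if i = 0 then 0 else x + z)"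
  unfolding Zmod_sum_machine_orbits
  by (cases i) (auto simp: Zmod_sum_act_def machine_orbits_def)

lemma exec_instr_bounded: "instr_bounded m I \<Longrightarrow> fst (exec_instr I v) < m"
  by (cases I) auto

lemma machine_delta_in_states:
  assumes "well_formed P" "q \<in> Zmod_sum (machine_orbits P)"
  shows "machine_delta P V q a \<in> Zmod_sum (machine_orbits P)"
proof -
  obtain i x where q: "q = (i, x)" by fastforce
  show ?thesis
  proof (cases i)
    case 0
    then show ?thesis
      using assms q by (auto simp: machine_delta_def Zmod_sum_machine_orbits well_formed_def)
  next
    case (Suc i')
    then have "instr_bounded (length P) (P ! i')"
      using assms q by (auto simp: Zmod_sum_machine_orbits well_formed_def)
    from exec_instr_bounded[OF this, of "x - a"] show ?thesis
      using Suc q by (auto simp: machine_delta_def step_def Zmod_sum_machine_orbits split: prod.split)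
  qed
qed

lemma translation_action_machine:
  "translation_action (Zmod_sum (machine_orbits P)) (Zmod_sum_act (machine_orbits P))"
  unfolding translation_action_def
  by (auto simp: Zmod_sum_act_machine_orbits Zmod_sum_machine_orbits)

lemma orbit_finite_machine:
  "orbit_finite (Zmod_sum (machine_orbits P)) (Zmod_sum_act (machine_orbits P))"
proof -
  let ?R = "(\<lambda>i. (i, 0::int)) ` {..length P}"
  have R: "?R \<subseteq> Zmod_sum (machine_orbits P)" by (auto simp: Zmod_sum_machine_orbits)
  have "Zmod_sum (machine_orbits P) = (\<Union>q\<in>?R. range (\<lambda>z. Zmod_sum_act (machine_orbits P) z q))"
  proof (intro equalityI subsetI)
    fix q assume q: "q \<in> Zmod_sum (machine_orbits P)"
    obtain i x where ix: "q = (i, x)" by fastforce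
    then have i: "i \<le> length P" using q by (auto simp: Zmod_sum_machine_orbits)
    then have "(i, 0) \<in> Zmod_sum (machine_orbits P)" by (auto simp: Zmod_sum_machine_orbits)
    then have "q = Zmod_sum_act (machine_orbits P) x (i, 0)"
      using q ix by (auto simp: Zmod_sum_act_machine_orbits Zmod_sum_machine_orbits)
    then show "q \<in> (\<Union>q\<in>?R. range (\<lambda>z. Zmod_sum_act (machine_orbits P) z q))" using i by blast
  next
    fix q assume "q \<in> (\<Union>q\<in>?R. range (\<lambda>z. Zmod_sum_act (machine_orbits P) z q))"
    then show "q \<in> Zmod_sum (machine_orbits P)"
      using R translation_action_machine[of P] unfolding translation_action_def by blast
  qed
  then show ?thesis using R unfolding orbit_finite_def by (intro exI[of _ ?R]) simp
qed

lemma orbit_finite_UNIV_plus: "orbit_finite UNIV ((+) :: int \<Rightarrow> int \<Rightarrow> int)"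
  unfolding orbit_finite_def by (intro exI[of _ "{0}"]) auto

lemma machine_delta_equivariant:
  assumes "well_formed P" "q \<in> Zmod_sum (machine_orbits P)"
  shows "machine_delta P V (Zmod_sum_act (machine_orbits P) z q) (z + a) =
    Zmod_sum_act (machine_orbits P) z (machine_delta P V q a)"
proof -
  obtain i x where q: "q = (i, x)" by fastforce
  obtain j y where d: "machine_delta P V q a = (j, y)" by fastforce
  have "(j, y) \<in> Zmod_sum (machine_orbits P)" using machine_delta_in_states[OF assms] d by metis
  \<comment> \<open>Orbit 0 is never entered, so the translation really adds \<open>z\<close> to the
    target.\<close>
  moreover have "j \<noteq> 0" using d q by (auto simp: machine_delta_def split: nat.splits prod.splits)
  ultimately show ?thesis
    using assms(2) q d
    by (auto simp: Zmod_sum_act_machine_orbits machine_delta_def split: nat.splits prod.splits)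
qed

lemma equivariant_machine_dfa:
  assumes "well_formed P"
  shows "equivariant_dfa (machine_dfa P V)"
proof -
  have pos: "length P \<ge> 1" using assms by (simp add: well_formed_def)
  have "Zmod_sum_act (machine_orbits P) z ` ({1} \<times> UNIV) = {1} \<times> UNIV" for z
  proof -
    have "Zmod_sum_act (machine_orbits P) z (1, x) = (1, x + z)" for x
      using Zmod_sum_act_machine_orbits[of 1 x P z] pos by (simp add: Zmod_sum_machine_orbits)
    then have act: "Zmod_sum_act (machine_orbits P) z p = (1, snd p + z)" if "fst p = 1" for p
      using that by (metis prod.collapse)
    have "p \<in> Zmod_sum_act (machine_orbits P) z ` ({1} \<times> UNIV)" if "p \<in> {1} \<times> UNIV" for p
      using that act[of "(1, snd p - z)"] by (intro rev_image_eqI[of "(1, snd p - z)"]) auto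
    then show ?thesis using act by auto
  qed
  moreover have "translation_action UNIV ((+) :: int \<Rightarrow> int \<Rightarrow> int)"
    by (simp add: translation_action_def)
  ultimately show ?thesis
    unfolding equivariant_dfa_def dfa_with_atoms_def machine_dfa_def
    using assms pos machine_delta_equivariant machine_delta_in_states translation_action_machine
      orbit_finite_machine orbit_finite_UNIV_plus
    by (auto simp: Zmod_sum_machine_orbits Zmod_sum_act_machine_orbits)
qed

section \<open>Presentation of the transition graph\<close>

lemma mono_offsets_small: "k \<le> 1 \<Longrightarrow> l \<le> 1 \<Longrightarrow> mono_offsets [k, 0, l] = [[0, 0, 0]]"
  by (auto simp: mono_offsets_def le_Suc_eq)

text \<open>With all moduli 0 or 1 a component consists of a single copy with zero offsets, so one
  formula presents it.\<close>

lemma presents_mono_subset_small: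
  assumes "k \<le> 1" "l \<le> 1" "S \<subseteq> monomial [k, 0, l]" "fvars_below (mono_dim [k, 0, l]) \<phi>"
    and "\<And>ys. length ys = mono_dim [k, 0, l] \<Longrightarrow>
      mono_copy [k, 0, l] [0, 0, 0] ys \<in> S \<longleftrightarrow> sat ((!) ys) \<phi>"
  shows "presents_mono_subset [k, 0, l] [\<phi>] S"
  using assms by (auto simp: presents_mono_subset_def mono_offsets_small defines_set_def)

lemma presents_mono_subset_empty:
  assumes "k \<le> 1" "l \<le> 1"
  shows "presents_mono_subset [k, 0, l] [false_form] {}"
  using assms by (intro presents_mono_subset_small) (auto simp: false_form_def)

lemma delta_component_machine:
  "delta_component (machine_dfa P V) id i j =
    {[x, a, y] | x a y. (i, x) \<in> Zmod_sum (machine_orbits P) \<and> machine_delta P V (i, x) a = (j, y)}"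
  by (auto simp: delta_component_def machine_dfa_def)

lemma delta_component_machine_init:
  "delta_component (machine_dfa P V) id 0 j = {[0, a, a + int V] | a. j = 2}"
  unfolding delta_component_machine
  by (auto simp: Zmod_sum_machine_orbits machine_delta_def)

lemma delta_component_machine_Suc:
  assumes "i < length P"
  shows "delta_component (machine_dfa P V) id (Suc i) j =
    {[x, a, y] | x a y. \<exists>j'. j = Suc j' \<and> exec_instr (P ! i) (x - a) = (j', y - a)}"
proof -
  have "machine_delta P V (Suc i, x) a = (j, y) \<longleftrightarrow>
      (\<exists>j'. j = Suc j' \<and> exec_instr (P ! i) (x - a) = (j', y - a))" for x a y
    by (auto simp: machine_delta_def step_def split: prod.splits)
  moreover have "(Suc i, x) \<in> Zmod_sum (machine_orbits P)" for x
    using assms by (simp add: Zmod_sum_machine_orbits)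
  ultimately show ?thesis unfolding delta_component_machine by simp
qed

lemma presents_machine_init:
  "presents_mono_subset [1, 0, 0] [init_form V] (delta_component (machine_dfa P V) id 0 2)"
proof (rule presents_mono_subset_small)
  show "delta_component (machine_dfa P V) id 0 2 \<subseteq> monomial [1, 0, 0]"
    by (auto simp: delta_component_machine_init monomial_def Zmod_def)
  show "fvars_below (mono_dim [1, 0, 0]) (init_form V)" by (simp add: init_form_def mono_dim_def)
  fix ys :: "int list"
  assume "length ys = mono_dim [1, 0, 0]"
  then obtain a y where "ys = [a, y]" by (auto simp: mono_dim_def length_Suc_conv)
  then show "mono_copy [1, 0, 0] [0, 0, 0] ys \<in> delta_component (machine_dfa P V) id 0 2 \<longleftrightarrow>
      sat ((!) ys) (init_form V)"
    by (auto simp: delta_component_machine_init mono_copy_def init_form_def)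
qed simp_all

lemma presents_machine_step:
  assumes "well_formed P" "i < length P"
  shows "presents_mono_subset [0, 0, 0] [step_form (P ! i) j]
    (delta_component (machine_dfa P V) id (Suc i) (Suc j))"
proof (rule presents_mono_subset_small)
  show "delta_component (machine_dfa P V) id (Suc i) (Suc j) \<subseteq> monomial [0, 0, 0]"
    by (auto simp: delta_component_machine_Suc[OF assms(2)] monomial_def Zmod_def)
  show "fvars_below (mono_dim [0, 0, 0]) (step_form (P ! i) j)"
    using fvars_below_step_form by (simp add: mono_dim_def numeral_3_eq_3)
  have I: "instr_bounded (length P) (P ! i)" using assms by (simp add: well_formed_def)
  fix ys :: "int list"
  assume "length ys = mono_dim [0, 0, 0]"
  then obtain x a y where "ys = [x, a, y]" by (auto simp: mono_dim_def length_Suc_conv)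
  then show "mono_copy [0, 0, 0] [0, 0, 0] ys \<in> delta_component (machine_dfa P V) id (Suc i) (Suc j)
      \<longleftrightarrow> sat ((!) ys) (step_form (P ! i) j)"
    by (simp add: delta_component_machine_Suc[OF assms(2)] mono_copy_def sat_step_form[OF I])
qed simp_all

lemma states_iso_machine: "states_iso (machine_dfa P V) (machine_orbits P) id"
  by (simp add: states_iso_def machine_dfa_def)

text \<open>The cases follow the blocks of the table: the row of the initial state, the column
  leading back to it, and the machine steps. The result yields both the presentation and
  semilinearity.\<close>

lemma presents_machine_table:
  assumes "well_formed P" "i \<le> length P" "j \<le> length P"
  shows "presents_mono_subset [machine_orbits P ! i, 0, machine_orbits P ! j]
    (snd (snd (snd (machine_code P V))) ! i ! j) (delta_component (machine_dfa P V) id i j)"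
proof (cases i)
  case 0
  have small: "machine_orbits P ! j \<le> 1" using assms by (cases j) (auto simp: machine_orbits_def)
  show ?thesis
  proof (cases "j = 2")
    case True
    then show ?thesis
      using 0 presents_machine_init[of V P] assms
      by (simp add: machine_orbits_def machine_code_def numeral_2_eq_2)
  next
    case False
    then have "snd (snd (snd (machine_code P V))) ! i ! j = [false_form]"
      using 0 assms by (auto simp: machine_code_def nth_Cons split: nat.splits)
    then show ?thesis
      using 0 False small presents_mono_subset_empty[of 1]
      by (simp add: delta_component_machine_init machine_orbits_def)
  qed
next
  case (Suc i')
  then have i': "i' < length P" using assms by simp
  show ?thesis
  proof (cases j)
    case 0
    then show ?thesis
      using Suc i' presents_mono_subset_empty[of 0 1]
      by (simp add: delta_component_machine_Suc[OF i'] machine_orbits_def machine_code_def)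
  next
    case j: (Suc j')
    then show ?thesis
      using Suc i' assms presents_machine_step[OF assms(1) i', of j' V]
      by (simp add: machine_orbits_def machine_code_def)
  qed
qed

lemma code_presents_machine:
  assumes "well_formed P"
  shows "code_presents (machine_code P V) (machine_dfa P V)"
proof -
  obtain tab where tab: "machine_code P V = (machine_orbits P, 0, [1], tab)"
    by (simp add: machine_code_def)
  have len: "length tab = length (machine_orbits P)"
    "\<forall>i<length (machine_orbits P). length (tab ! i) = length (machine_orbits P)"
    using tab assms
    by (auto simp: machine_code_def machine_orbits_def well_formed_def nth_Cons split: nat.splits)
  have "{(i, x) \<in> Zmod_sum (machine_orbits P). i \<in> set [1]} = {1} \<times> UNIV"
    using assms by (auto simp: Zmod_sum_machine_orbits well_formed_def)
  moreover have "presents_mono_subset [machine_orbits P ! i, 0, machine_orbits P ! j]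
      (tab ! i ! j) (delta_component (machine_dfa P V) id i j)"
    if "i < length (machine_orbits P)" "j < length (machine_orbits P)" for i j
    using presents_machine_table[OF assms, of i j V] that tab by (simp add: machine_orbits_def)
  ultimately show ?thesis
    unfolding tab code_presents.simps
    using len states_iso_machine by (intro exI[of _ id]) (simp add: machine_dfa_def)
qed

lemma semilinear_machine_dfa:
  assumes "well_formed P"
  shows "semilinear_dfa (machine_dfa P V)"
proof -
  have "semilinear_mono_subset [machine_orbits P ! i, 0, machine_orbits P ! j]
      (delta_component (machine_dfa P V) id i j)"
    if "i < length (machine_orbits P)" "j < length (machine_orbits P)" for i j
    using presents_machine_table[OF assms, of i j V] that
    unfolding semilinear_mono_subset_def by (auto simp: machine_orbits_def)
  then show ?thesis using states_iso_machine unfolding semilinear_dfa_def by blast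
qed

section \<open>Runs on constant words\<close>

lemma foldl_machine_delta:
  "foldl (machine_delta P V) (0, 0) (replicate (Suc n) a) =
    (case (step P ^^ n) (1, int V) of (i, w) \<Rightarrow> (Suc i, a + w))"
proof (induction n)
  case 0
  \<comment> \<open>The first letter only loads \<open>V\<close>, so \<open>Suc n\<close> letters
    perform \<open>n\<close> steps.\<close>
  show ?case by (simp add: machine_delta_def)
next
  case (Suc n)
  have "replicate (Suc (Suc n)) a = replicate (Suc n) a @ [a]"
    by (simp add: replicate_append_same)
  then have "foldl (machine_delta P V) (0, 0) (replicate (Suc (Suc n)) a) =
      machine_delta P V (foldl (machine_delta P V) (0, 0) (replicate (Suc n) a)) a"
    by (simp del: replicate_Suc)
  \<comment> \<open>As the next letter is again \<open>a\<close>, the difference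
    \<open>(a + w) - a\<close> recovers the machine integer.\<close>
  then show ?case unfolding Suc by (simp add: machine_delta_def split: prod.split)
qed

lemma machine_dfa_accepts_iff:
  "(\<exists>a n. accepts (machine_dfa P V) (replicate n a)) \<longleftrightarrow> (\<exists>v. reaches P (1, int V) (0, v))"
proof -
  \<comment> \<open>The empty word stays in orbit 0, which is not accepting; for all other words the
    letter has no influence on acceptance.\<close>
  have "accepts (machine_dfa P V) (replicate n a) \<longleftrightarrow>
      (\<exists>m. n = Suc m \<and> fst ((step P ^^ m) (1, int V)) = 0)" for n a
    by (cases n)
      (auto simp: accepts_def machine_dfa_def foldl_machine_delta simp del: replicate_Suc
        split: prod.splits)
  then show ?thesis unfolding reaches_def by (metis fst_conv prod.collapse)
qed


section \<open>Diagonalisation\<close>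

definition encode_row :: "pform list list \<Rightarrow> nat" where
  "encode_row row = list_encode (map (\<lambda>\<phi>s. list_encode (map encode_pform \<phi>s)) row)"

text \<open>The three arguments \<open>K\<close>, \<open>R\<close>, \<open>T\<close> make up all of the code of the automaton that depends on the
  program; they also determine the initial integer, so that the machine receives them as input.\<close>

definition initial_value :: "nat \<Rightarrow> nat \<Rightarrow> nat \<Rightarrow> nat" where
  "initial_value K R T = nth_prime 0 ^ K * (nth_prime 1 ^ R * nth_prime 2 ^ T)"

text \<open>This is \<open>encode_dfa_code\<close> of a machine code with the list encodings
  unfolded far enough to expose \<open>V\<close>. The arguments encode the orbits after the first,
  the first row after its third entry, and the remaining rows; \<open>2 * n\<close> is the integer
  code of a natural number \<open>n\<close>.\<close>

definition self_code :: "nat list \<Rightarrow> nat" where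
  "self_code xs =
    prod_encode (Suc (prod_encode (1, xs ! 0)), prod_encode (0, prod_encode (list_encode [1],
      Suc (prod_encode (
        Suc (prod_encode (list_encode [encode_pform false_form],
          Suc (prod_encode (list_encode [encode_pform false_form],
            Suc (prod_encode (
              Suc (prod_encode (prod_encode (0, prod_encode (prod_encode (0, 1), prod_encode (2,
                prod_encode (prod_encode (0, 0), prod_encode (1,
                  2 * initial_value (xs ! 0) (xs ! 1) (xs ! 2)))))), 0)),
              xs ! 1)))))),
        xs ! 2)))))"

lemma recursive_self_code: "recursive 3 self_code"
  unfolding self_code_def initial_value_def
  by (intro recursive_prod_encode recursive_Suc recursive_mult recursive_power recursive_const
      recursive_arg) simp_all

lemma encode_machine_code:
  assumes "K = list_encode (replicate (length P) 0)"
    and "R = encode_row (replicate (length P - 2) [false_form])"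
    and "T = list_encode (map (\<lambda>I. encode_row ([false_form] # map (\<lambda>j. [step_form I j]) [0..<length P])) P)"
  shows "encode_dfa_code (machine_code P (initial_value K R T)) = self_code [K, R, T]"
proof -
  have "int_encode (int n) = 2 * n" for n by (simp add: int_encode_def sum_encode_def)
  then show ?thesis
    unfolding machine_code_def self_code_def machine_orbits_def init_form_def
    using assms by (simp add: encode_row_def comp_def)
qed

text \<open>The first and last addresses are self-loops. Output 0 leads to address 0, where the
  automaton accepts; any other output leads to the last address, a rejecting trap.\<close>

definition diagonal_program :: "cmd \<Rightarrow> nat \<Rightarrow> instr list" where
  "diagonal_program c out =
    Mul 1 0 # compile 1 c @
      [Div (nth_prime out) (length (compile 1 c) + 2) 0, Mul 1 (length (compile 1 c) + 2)]"

lemma well_formed_diagonal_program: "well_formed (diagonal_program c out)"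
  using instr_bounded_compile[of _ 1 c "length (diagonal_program c out)"]
    prime_gt_0_nat[OF prime_nth_prime[of out]]
  by (auto simp: well_formed_def diagonal_program_def)

lemma funpow_step_trap:
  assumes "P ! i = Mul 1 i"
  shows "(step P ^^ n) (i, v) = (i, v)"
  using assms by (induction n) (auto simp: step_def)

text \<open>A trap is never left, so after the combined number of steps the deterministic run is in
  both traps.\<close>

lemma reaches_trap_unique:
  assumes i: "P ! i = Mul 1 i" "reaches P a (i, v)" and j: "P ! j = Mul 1 j" "reaches P a (j, w)"
  shows "i = j"
proof -
  obtain m n where m: "(step P ^^ m) a = (i, v)" and n: "(step P ^^ n) a = (j, w)"
    using i j by (auto simp: reaches_def)
  have "(i, v) = (step P ^^ (n + m)) a"
    by (simp only: funpow_add comp_apply m funpow_step_trap[OF i(1)])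
  also have "\<dots> = (step P ^^ (m + n)) a" by (simp only: add.commute)
  also have "\<dots> = (j, w)" by (simp only: funpow_add comp_apply n funpow_step_trap[OF j(1)])
  finally show ?thesis by simp
qed

text \<open>The terminating execution of \<open>c\<close> brings the machine to the final test,
  which selects one of the two traps; reaching one excludes the other.\<close>

lemma diagonal_program_halts_iff:
  assumes "exec c \<sigma> \<sigma>'" "represents V \<sigma>"
  shows "(\<exists>v. reaches (diagonal_program c out) (1, V) (0, v)) \<longleftrightarrow> \<sigma>' out = 0"
proof -
  let ?P = "diagonal_program c out" and ?l = "length (compile 1 c)"
  obtain v where v: "represents v \<sigma>'" "reaches ?P (1, V) (1 + ?l, v)"
    using compile_correct[OF assms(1), of ?P "[Mul 1 0]" _ V] assms(2)
    by (auto simp: diagonal_program_def)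
  have test: "?P ! (1 + ?l) = Div (nth_prime out) (?l + 2) 0"
    by (simp add: diagonal_program_def nth_append)
  have trap: "?P ! 0 = Mul 1 0" "?P ! (?l + 2) = Mul 1 (?l + 2)"
    by (simp_all add: diagonal_program_def nth_append)
  show ?thesis
  proof (cases "\<sigma>' out = 0")
    case True
    then have "step ?P (1 + ?l, v) = (0, v)"
      using test represents_dvd_iff[OF v(1), of out] by (simp add: step_def)
    then show ?thesis using True reaches_trans[OF v(2) reaches_step] by blast
  next
    case False
    then have "step ?P (1 + ?l, v) = (?l + 2, v div int (nth_prime out))"
      using test represents_dvd_iff[OF v(1), of out] by (simp add: step_def)
    then have "reaches ?P (1, V) (?l + 2, v div int (nth_prime out))"
      using reaches_trans[OF v(2) reaches_step] by blast
    then show ?thesis using reaches_trap_unique[OF trap(1) _ trap(2)] False by fastforce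
  qed
qed

lemma represents_initial_value:
  "represents (int (initial_value K R T)) ((\<lambda>_. 0)(2 := T, 1 := R, 0 := K))"
proof -
  have "represents 1 (\<lambda>_. 0)"
    using prime_int_nth_prime not_prime_unit
    by (auto simp: represents_def intro!: not_dvd_imp_multiplicity_0)
  from represents_power_mult[OF represents_power_mult[OF represents_power_mult[OF this, of 2 T],
        of 1 R], of 0 K]
  show ?thesis by (simp add: initial_value_def)
qed

theorem theorem3:
  "\<not> decidable_problem dfa_presentation
      {M :: (nat \<times> int, int) dfa. equivariant_dfa M \<and> semilinear_dfa M \<and> integer_alphabet M}
      (\<lambda>M. \<exists>(x::int) n. accepts M (replicate n x))"
proof
  assume "decidable_problem dfa_presentation
      {M :: (nat \<times> int, int) dfa. equivariant_dfa M \<and> semilinear_dfa M \<and> integer_alphabet M}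
      (\<lambda>M. \<exists>(x::int) n. accepts M (replicate n x))"
  then obtain f where f: "\<And>k (M :: (nat \<times> int, int) dfa). equivariant_dfa M \<Longrightarrow> semilinear_dfa M \<Longrightarrow>
      integer_alphabet M \<Longrightarrow> dfa_presentation k M \<Longrightarrow>
      rec_eval f [k] (if \<exists>(x::int) n. accepts M (replicate n x) then 1 else 0)"
    unfolding decidable_problem_def by blast
  obtain s where s: "\<And>xs. length xs = 3 \<Longrightarrow> rec_eval s xs (self_code xs)"
    using recursive_self_code by (auto simp: recursive_def)
  \<comment> \<open>The inputs are in registers 0 to 2, matching the primes of
    \<open>initial_value\<close>; the answer goes to register 3.\<close>
  obtain c where c: "computes c (Comp f [s]) [0, 1, 2] 3 4"
    using implementableD[OF implementable_all, of "[0, 1, 2]" 4 3 "Comp f [s]"] by auto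
  \<comment> \<open>The program is fixed before \<open>K\<close>, \<open>R\<close>,
    \<open>T\<close>, which describe it and reach it only through the initial integer. Hence the
    self-reference is not circular.\<close>
  define P where "P = diagonal_program c 3"
  define K where "K = list_encode (replicate (length P) 0)"
  define R where "R = encode_row (replicate (length P - 2) [false_form])"
  define T where "T = list_encode (map (\<lambda>I. encode_row
    ([false_form] # map (\<lambda>j. [step_form I j]) [0..<length P])) P)"
  define M where "M = machine_dfa P (initial_value K R T)"
  let ?acc = "\<exists>(x::int) n. accepts M (replicate n x)"
  have P: "well_formed P" unfolding P_def by (rule well_formed_diagonal_program)
  have "dfa_presentation (self_code [K, R, T]) M"
    unfolding dfa_presentation_def M_def
    using code_presents_machine[OF P] encode_machine_code[OF K_def R_def T_def] by metis
  moreover have "integer_alphabet M" by (simp add: M_def integer_alphabet_def machine_dfa_def)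
  ultimately have "rec_eval f [self_code [K, R, T]] (if ?acc then 1 else 0)"
    using equivariant_machine_dfa[OF P] semilinear_machine_dfa[OF P] by (intro f) (auto simp: M_def)
  then have ev: "rec_eval (Comp f [s]) [K, R, T] (if ?acc then 1 else 0)"
    using s[of "[K, R, T]"] by (intro rec_eval.intros(4)[of _ _ "[self_code [K, R, T]]"]) auto
  define \<sigma> where "\<sigma> = ((\<lambda>_. 0)(2 := T, 1 := R, 0 := K) :: nat \<Rightarrow> nat)"
  have "map \<sigma> [0, 1, 2] = [K, R, T]" by (simp add: \<sigma>_def)
  with ev have "rec_eval (Comp f [s]) (map \<sigma> [0, 1, 2]) (if ?acc then 1 else 0)" by (simp only:)
  then obtain \<sigma>' where \<sigma>': "exec c \<sigma> \<sigma>'" "\<sigma>' 3 = (if ?acc then 1 else 0)"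
    by (rule computesD[OF c])
  have "represents (int (initial_value K R T)) \<sigma>"
    unfolding \<sigma>_def by (rule represents_initial_value)
  \<comment> \<open>The automaton accepts exactly when the answer computed about it is 0, that is,
    when \<open>f\<close> denies acceptance.\<close>
  from diagonal_program_halts_iff[OF \<sigma>'(1) this, of 3]
  have "?acc \<longleftrightarrow> \<sigma>' 3 = 0" unfolding M_def machine_dfa_accepts_iff P_def .
  then show False using \<sigma>'(2) by (cases ?acc) simp_all
qed

end
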